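(* Let $G$ be a finite connected 2-edge-connected graph. The graphic matroid ${\mathcal M}(G)$ is computed, up to isomorphism, from the lattice ${\mathcal F}(G)$ by the following procedure: (1) List the codimension one faces of the Voronoi cell $V(G)$; each is $F_C$ for a unique oriented circuit $C$. Use them to choose a circuit basis $\{C_1,\dots,C_r\}$ of ${\mathcal F}(G)$ such that for all $i\neq j$, the face $F_{C_i}$ intersects $F_{C_j}$ or intersects $F_{-C_j}$. Such a basis exists and is cancellation-free. (2) List the edges of $V(G)$ and group them into parallel classes $[\epsilon]$. For each oriented circuit $C$, record which classes have a member contained in $F_C$. (3) Write the equations $\sum_{[\epsilon]\notin F_{C_i}} n_{[\epsilon]}=(C_i,C_i)$ for $i=1,\dots,r$, and $\sum_{[\epsilon]\notin F_{C_i},F_{C_j}} n_{[\epsilon]}=|(C_i,C_j)|$ for $i\ne j$. (4) This system has a unique positive integer solution $\{n_{[\epsilon]}\}$. (5) The ground set $E(G)$ of ${\mathcal M}(G)$ is a disjoint union of sets $S_{[\epsilon]}$ with $|S_{[\epsilon]}|=n_{[\epsilon]}$. (6) An edge $e\in S_{[\epsilon]}$ belongs to a circuit $C$ if and only if no member of the class $[\epsilon]$ is contained in the face $F_C$. In particular, the matroid is determined as follows. Take the ground set $\bigsqcup_{[\epsilon]} S_{[\epsilon]}$ with $|S_{[\epsilon]}|=n_{[\epsilon]}$. For each pair $\{F_C,F_{-C}\}$ of opposite codimension one faces, take the circuit $\bigcup_{[\epsilon]\notin F_C} S_{[\epsilon]}$. The resulting matroid is isomorphic to ${\mathcal M}(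G)$.
   Context: Graphs may have loops and multiple edges. $G$ is 2-edge-connected if deleting any one edge leaves it connected. A circuit is a closed walk repeating no vertex and no edge; an oriented circuit carries a cyclic orientation, and $-C$ is its reverse. The graphic matroid ${\mathcal M}(G)$ has ground set $E(G)$ and circuits the edge sets of circuits of $G$. Fix a reference orientation of $G$. The lattice of integer flows ${\mathcal F}(G)\subset\mathbb Z^{E(G)}$ consists of integer edge weightings with inflow equal to outflow at every vertex. It has the inner product restricted from the standard one. An oriented circuit $C$ gives the circuit element $C\in{\mathcal F}(G)$, with coefficient $\pm1$ on its edges (according to agreement with the reference orientation) and $0$ elsewhere. A circuit basis is a basis of ${\mathcal F}(G)$ of circuit elements. It is cancellation-free if for all basis circuits $C_i,C_j$ the number of common edges equals $|(C_i,C_j)|$. The Voronoi cell is $V(G)=\{x\in{\mathcal F}(G)\otimes\mathbb R:(x,x)\le(x-v,x-v)\ \forall v\in{\mathcal F}(G)\}$. Its codimension one faces are exactly $F_C=V(G)\cap\{x:(x,C)=(C,C)/2\}$ for oriented circuits $C$, and $F_{-C}=-F_C$. Edges of $V(G)$ are its one-dimensional faces; two edges are parallel if they are translates in direction. $[\epsilon]\notin F$ means no member of the parallel class $[\epsilon]$ lies in the face $F$. *)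

theory Defs
  imports
    "HOL-Analysis.Analysis"
    "HOL-Library.FuncSet"
    "Graph_Theory.Digraph_Component"
    "Graph_Theory.Arc_Walk"
begin

section \<open>Graphs, oriented circuits and integer flows\<close>

text \<open>
  A graph with a fixed reference orientation is a \<open>pre_digraph\<close>; the orientation itself is
  immaterial for connectedness, since \<open>Digraph_Component.connected\<close> refers to the symmetric closure.
  The edge type is finite but \<open>arcs G\<close> may be a proper (even empty) subset of it, so that
  weightings of the edges can be taken in \<open>real ^ 'e\<close>, vanishing off \<open>arcs G\<close>.
\<close>

definition two_edge_connected :: "('v, 'e) pre_digraph \<Rightarrow> bool" where
  "two_edge_connected G \<longleftrightarrow>
     (\<forall>e\<in>arcs G. Digraph_Component.connected (pre_digraph.del_arc G e))"

text \<open>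
  Each edge \<open>e\<close> gives two darts: \<open>(e, True)\<close> traverses \<open>e\<close> along the reference orientation and
  \<open>(e, False)\<close> against it. Walks in the undirected graph are arc walks in the digraph of darts.
\<close>

definition dart_digraph :: "('v, 'e) pre_digraph \<Rightarrow> ('v, 'e \<times> bool) pre_digraph" where
  "dart_digraph G =
     \<lparr> verts = verts G,
       arcs = arcs G \<times> UNIV,
       tail = (\<lambda>(e, b). if b then tail G e else head G e),
       head = (\<lambda>(e, b). if b then head G e else tail G e) \<rparr>"

text \<open>
  \<open>pre_digraph.cycle\<close> excludes repeated vertices; repeated edges must be excluded separately
  because of the walks \<open>[(e, True), (e, False)]\<close>. Passing to the set of darts identifies the
  rotations of a closed walk and nothing else.
\<close>

definition oriented_circuits :: "('v, 'e) pre_digraph \<Rightarrow> ('e \<times> bool) set set" where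
  "oriented_circuits G =
     {set p | p. pre_digraph.cycle (dart_digraph G) p \<and> distinct (map fst p)}"

definition circuit_edges :: "('e \<times> bool) set \<Rightarrow> 'e set" where
  "circuit_edges c = fst ` c"

definition circuit_element :: "('e::finite \<times> bool) set \<Rightarrow> real ^ 'e" where
  "circuit_element c = (\<chi> e. if (e, True) \<in> c then 1 else if (e, False) \<in> c then - 1 else 0)"

definition flow_lattice :: "('v, 'e::finite) pre_digraph \<Rightarrow> (real ^ 'e) set" where
  "flow_lattice G =
     {f. (\<forall>e. f $ e \<in> \<int>) \<and> (\<forall>e. e \<notin> arcs G \<longrightarrow> f $ e = 0) \<and>
         (\<forall>v\<in>verts G. (\<Sum>e\<in>in_arcs G v. f $ e) = (\<Sum>e\<in>out_arcs G v. f $ e))}"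

definition lattice_basis :: "'a::real_vector set \<Rightarrow> 'a set \<Rightarrow> bool" where
  "lattice_basis L B \<longleftrightarrow> finite B \<and> B \<subseteq> L \<and>
     (\<forall>v\<in>L. \<exists>!a. a \<in> B \<rightarrow>\<^sub>E (UNIV :: int set) \<and> v = (\<Sum>b\<in>B. real_of_int (a b) *\<^sub>R b))"

definition circuit_basis :: "('v, 'e::finite) pre_digraph \<Rightarrow> (real ^ 'e) set \<Rightarrow> bool" where
  "circuit_basis G B \<longleftrightarrow>
     B \<subseteq> circuit_element ` oriented_circuits G \<and> lattice_basis (flow_lattice G) B"

definition cancellation_free :: "('v, 'e::finite) pre_digraph \<Rightarrow> (real ^ 'e) set \<Rightarrow> bool" where
  "cancellation_free G B \<longleftrightarrow>
     (\<forall>c\<in>oriented_circuits G. \<forall>d\<in>oriented_circuits G.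
        circuit_element c \<in> B \<longrightarrow> circuit_element d \<in> B \<longrightarrow>
        real (card (circuit_edges c \<inter> circuit_edges d)) = \<bar>circuit_element c \<bullet> circuit_element d\<bar>)"

section \<open>The Voronoi cell of a lattice\<close>

text \<open>
  The notions in this section take only a lattice \<open>L\<close> in some Euclidean space, not a graph.
  \<open>L \<otimes> \<real>\<close> is realised as the linear span of \<open>L\<close>.
\<close>

definition voronoi_cell :: "'a::euclidean_space set \<Rightarrow> 'a set" where
  "voronoi_cell L = {x \<in> span L. \<forall>v\<in>L. x \<bullet> x \<le> (x - v) \<bullet> (x - v)}"

definition voronoi_face :: "'a::euclidean_space set \<Rightarrow> 'a \<Rightarrow> 'a set" where
  "voronoi_face L v = voronoi_cell L \<inter> {x. x \<bullet> v = (v \<bullet> v) / 2}"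

definition cell_edges :: "'a::euclidean_space set \<Rightarrow> 'a set set" where
  "cell_edges L = {\<epsilon>. \<epsilon> face_of voronoi_cell L \<and> aff_dim \<epsilon> = 1}"

definition edge_classes :: "'a::euclidean_space set \<Rightarrow> 'a set set set" where
  "edge_classes L = cell_edges L //
     {(\<epsilon>, \<delta>) \<in> cell_edges L \<times> cell_edges L. affine_parallel (affine hull \<epsilon>) (affine hull \<delta>)}"

text \<open>The classes \<open>[\<epsilon>]\<close> with \<open>[\<epsilon>] \<notin> F\<close>.\<close>

definition classes_avoiding :: "'a::euclidean_space set \<Rightarrow> 'a set \<Rightarrow> 'a set set set" where
  "classes_avoiding L F = {k \<in> edge_classes L. \<forall>\<epsilon>\<in>k. \<not> \<epsilon> \<subseteq> F}"

definition faces_meet_pairwise :: "'a::euclidean_space set \<Rightarrow> 'a set \<Rightarrow> bool" where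
  "faces_meet_pairwise L B \<longleftrightarrow>
     (\<forall>C\<in>B. \<forall>D\<in>B. C \<noteq> D \<longrightarrow>
        voronoi_face L C \<inter> voronoi_face L D \<noteq> {} \<or>
        voronoi_face L C \<inter> voronoi_face L (- D) \<noteq> {})"

text \<open>
  The unknowns are indexed by \<open>edge_classes L\<close>; extensionality makes a solution a function on
  that set only.
\<close>

definition positive_solution ::
    "'a::euclidean_space set \<Rightarrow> 'a set \<Rightarrow> ('a set set \<Rightarrow> nat) \<Rightarrow> bool" where
  "positive_solution L B n \<longleftrightarrow>
     n \<in> edge_classes L \<rightarrow>\<^sub>E {1..} \<and>
     (\<forall>C\<in>B. real (\<Sum>k \<in> classes_avoiding L (voronoi_face L C). n k) = C \<bullet> C) \<and>
     (\<forall>C\<in>B. \<forall>D\<in>B. C \<noteq> D \<longrightarrow>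
        real (\<Sum>k \<in> classes_avoiding L (voronoi_face L C) \<inter>
                    classes_avoiding L (voronoi_face L D). n k) = \<bar>C \<bullet> D\<bar>)"

section \<open>Matroids given by their circuits\<close>

text \<open>A pair consists of the ground set and the set of circuits.\<close>

type_synonym 'a circuit_system = "'a set \<times> 'a set set"

definition matroid :: "'a circuit_system \<Rightarrow> bool" where
  "matroid M \<longleftrightarrow> (case M of (E, \<C>) \<Rightarrow>
     finite E \<and> (\<forall>C\<in>\<C>. C \<subseteq> E) \<and> {} \<notin> \<C> \<and>
     (\<forall>C\<in>\<C>. \<forall>D\<in>\<C>. C \<subseteq> D \<longrightarrow> C = D) \<and>
     (\<forall>C\<in>\<C>. \<forall>D\<in>\<C>. \<forall>e\<in>C \<inter> D. C \<noteq> D \<longrightarrow> (\<exists>K\<in>\<C>. K \<subseteq> (C \<union> D) - {e})))"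

definition matroid_isomorphic :: "'a circuit_system \<Rightarrow> 'b circuit_system \<Rightarrow> bool" where
  "matroid_isomorphic M N \<longleftrightarrow>
     (\<exists>f. bij_betw f (fst M) (fst N) \<and> (\<lambda>C. f ` C) ` snd M = snd N)"

definition graphic_matroid :: "('v, 'e) pre_digraph \<Rightarrow> 'e circuit_system" where
  "graphic_matroid G = (arcs G, circuit_edges ` oriented_circuits G)"

text \<open>
  The disjoint union of the sets \<open>S k\<close> is the dependent sum over \<open>edge_classes L\<close>. Letting \<open>F\<close>
  range over all codimension one faces visits each pair of opposite faces twice; both members of
  a pair yield the same circuit, as the cell is centrally symmetric.
\<close>

definition reconstructed_matroid ::
    "'a::euclidean_space set \<Rightarrow> ('a set set \<Rightarrow> 'x set) \<Rightarrow> ('a set set \<times> 'x) circuit_system" where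
  "reconstructed_matroid L S =
     (Sigma (edge_classes L) S,
      {Sigma (classes_avoiding L F) S | F. F facet_of voronoi_cell L})"

end

theory Submission
  imports Defs
begin

text \<open>
  Everything rests on two properties of the flow space \<open>W\<close>: circuit vectors have entries in
  \<open>{-1, 0, 1}\<close> and minimal support, and every nonzero flow dominates a circuit with the same
  signs. Hence every flow is a conforming sum of circuits, the support function of the Voronoi cell
  is \<open>l1 / 2\<close>, and the cell is the projection to \<open>W\<close> of the cube with vertices \<open>\<plusminus>1/2\<close>. Its edges are
  therefore parallel to the projected unit vectors \<open>dual e\<close>, with \<open>dual e\<close> and \<open>dual f\<close> parallel
  iff \<open>e\<close> and \<open>f\<close> lie on the same circuits, and the face \<open>F\<^sub>C\<close> contains an edge of direction \<open>dual e\<close>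
  iff \<open>e\<close> is not on \<open>C\<close>. The faces of \<open>C\<close> and \<open>D\<close> meet iff \<open>C\<close> and \<open>D\<close> agree on their common
  edges. Agreeing bases come from an ear decomposition relative to a nowhere vanishing flow. The
  linear system expresses a quadratic form on \<open>W\<close> as a combination of squared coordinates, one per
  parallel class, and such squares are linearly independent.
\<close>

text \<open>The graph is replaced by \<open>regular_space\<close> because these axioms survive
  restriction to the vectors vanishing at one edge, within the same type \<open>real ^ 'e\<close>;
  inductions on the edges then need no graph surgery. Squares of linear forms are dependent in
  general: x, y, x + y and x - y have dependent squares. Entries in {-1, 0, 1} exclude this
  configuration, since a vector with x - y = 0 and x + y = 1 would have entries 1/2. Unimodularity
  thus enters twice, in the shape of the cell and in the uniqueness of the solution. The equations
  see only the absolute values |(C_i, C_j)|. Agreement of the basis circuits gives all products on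
  common edges one sign, so the difference of two solutions becomes a bilinear form that vanishes on
  pairs of basis circuits, hence on all of \<open>W\<close>. Two-edge-connectedness enters in
  identifying \<open>ground\<close> of the flow space with the arc set: an arc that carries no flow
  would be invisible to the lattice.\<close>

definition conforms :: "real ^ 'e::finite \<Rightarrow> real ^ 'e \<Rightarrow> bool" where
  "conforms c x \<longleftrightarrow> (\<forall>e. c $ e \<noteq> 0 \<longrightarrow> 0 < c $ e * x $ e)"

definition l1 :: "real ^ 'e::finite \<Rightarrow> real" where
  "l1 x = (\<Sum>e\<in>UNIV. \<bar>x $ e\<bar>)"

definition ground :: "(real ^ 'e::finite) set \<Rightarrow> 'e set" where
  "ground W = {e. \<exists>x\<in>W. x $ e \<noteq> 0}"

text \<open>Proportionality of two coordinate functionals in disguise, see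
  \<open>parallel_in_signed\<close>; for a flow space the classes inside \<open>ground W\<close> are
  the series classes of the graph. Coordinates outside \<open>ground W\<close> are all parallel to
  each other, hence the side conditions below.\<close>

definition parallel_in :: "(real ^ 'e::finite) set \<Rightarrow> 'e \<Rightarrow> 'e \<Rightarrow> bool" where
  "parallel_in W f a \<longleftrightarrow> (\<forall>x\<in>W. x $ f = 0 \<longleftrightarrow> x $ a = 0)"

section \<open>Sign-conformal decomposition, parallel coordinates and deletion\<close>

lemma l1_0 [simp]: "l1 0 = 0"
  by (simp add: l1_def)

lemma l1_scaleR: "l1 (t *\<^sub>R x) = \<bar>t\<bar> * l1 x"
  by (simp add: l1_def abs_mult sum_distrib_left)

lemma l1_add_eq_iff: "l1 (x + y) = l1 x + l1 y \<longleftrightarrow> (\<forall>e. 0 \<le> x $ e * y $ e)"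
proof -
  have "l1 (x + y) = l1 x + l1 y \<longleftrightarrow> (\<Sum>e\<in>UNIV. \<bar>x $ e\<bar> + \<bar>y $ e\<bar> - \<bar>x $ e + y $ e\<bar>) = 0"
    unfolding l1_def sum.distrib sum_subtractf vector_add_component by linarith
  also have "\<dots> \<longleftrightarrow> (\<forall>e\<in>UNIV. \<bar>x $ e\<bar> + \<bar>y $ e\<bar> - \<bar>x $ e + y $ e\<bar> = 0)"
    by (subst sum_nonneg_eq_0_iff) auto
  also have "\<dots> \<longleftrightarrow> (\<forall>e\<in>UNIV. 0 \<le> x $ e * y $ e)"
  proof (rule ball_cong)
    fix e
    show "\<bar>x $ e\<bar> + \<bar>y $ e\<bar> - \<bar>x $ e + y $ e\<bar> = 0 \<longleftrightarrow> 0 \<le> x $ e * y $ e"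
      unfolding zero_le_mult_iff by arith
  qed simp
  finally show ?thesis by simp
qed

lemma l1_triangle: "l1 (x + y) \<le> l1 x + l1 y"
  unfolding l1_def sum.distrib[symmetric] by (rule sum_mono) simp

lemma l1_eq_inner_self:
  assumes "\<And>e. x $ e \<in> {-1, 0, 1::real}"
  shows "l1 x = x \<bullet> x"
  unfolding l1_def inner_vec_def
proof (rule sum.cong)
  fix e show "\<bar>x $ e\<bar> = x $ e \<bullet> x $ e" using assms[of e] by auto
qed simp

lemma inner_le_l1:
  fixes x y :: "real ^ 'e::finite"
  assumes "\<And>e. \<bar>x $ e\<bar> \<le> 1/2"
  shows "x \<bullet> y \<le> l1 y / 2"
  unfolding l1_def inner_vec_def sum_divide_distrib
proof (rule sum_mono)
  fix e
  have "x $ e * y $ e \<le> \<bar>x $ e\<bar> * \<bar>y $ e\<bar>" by (metis abs_ge_self abs_mult)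
  also have "\<dots> \<le> 1/2 * \<bar>y $ e\<bar>" using assms by (intro mult_right_mono) auto
  finally show "x $ e \<bullet> y $ e \<le> \<bar>y $ e\<bar> / 2" by simp
qed

lemma parallel_in_sym: "parallel_in W a b \<Longrightarrow> parallel_in W b a"
  by (auto simp: parallel_in_def)

lemma parallel_in_trans: "parallel_in W a b \<Longrightarrow> parallel_in W b c \<Longrightarrow> parallel_in W a c"
  by (auto simp: parallel_in_def)

lemma parallel_in_ground: "parallel_in W a b \<Longrightarrow> a \<in> ground W \<longleftrightarrow> b \<in> ground W"
  by (auto simp: parallel_in_def ground_def)

text \<open>A regular matroid in vector form: \<open>C\<close> plays the role of its signed
  circuits, the unimodular vectors of minimal support in \<open>W\<close>. Closure of
  \<open>C\<close> under negation is a consequence, derived in \<open>circuit_minus\<close>.\<close>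

locale regular_space =
  fixes W C :: "(real ^ 'e::finite) set"
  assumes subspace_W: "subspace W"
    and circuit_in: "c \<in> C \<Longrightarrow> c \<in> W"
    and circuit_nonzero: "c \<in> C \<Longrightarrow> c \<noteq> 0"
    and circuit_entry: "c \<in> C \<Longrightarrow> c $ e \<in> {-1, 0, 1}"
    and circuit_elementary: "c \<in> C \<Longrightarrow> x \<in> W \<Longrightarrow> (\<And>e. c $ e = 0 \<Longrightarrow> x $ e = 0) \<Longrightarrow> \<exists>t. x = t *\<^sub>R c"
    and circuit_conforming: "x \<in> W \<Longrightarrow> x \<noteq> 0 \<Longrightarrow> \<exists>c\<in>C. conforms c x"
begin

lemma W_0 [simp]: "0 \<in> W"
  and W_add: "x \<in> W \<Longrightarrow> y \<in> W \<Longrightarrow> x + y \<in> W"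
  and W_diff: "x \<in> W \<Longrightarrow> y \<in> W \<Longrightarrow> x - y \<in> W"
  and W_scale: "x \<in> W \<Longrightarrow> t *\<^sub>R x \<in> W"
  and W_minus: "x \<in> W \<Longrightarrow> - x \<in> W"
  and W_sum: "(\<And>i. i \<in> I \<Longrightarrow> f i \<in> W) \<Longrightarrow> sum f I \<in> W"
  using subspace_W by (auto simp: subspace_0 subspace_add subspace_diff subspace_scale subspace_neg subspace_sum)

lemma circuit_cases:
  assumes "c \<in> C"
  obtains "c $ e = 1" | "c $ e = -1" | "c $ e = 0"
  using circuit_entry[OF assms, of e] by auto

lemma finite_C [simp]: "finite C"
proof -
  have "C \<subseteq> vec_lambda ` (UNIV \<rightarrow>\<^sub>E {-1, 0, 1})"
  proof
    fix c assume "c \<in> C"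
    then have "vec_nth c \<in> UNIV \<rightarrow>\<^sub>E {-1, 0, 1}" by (auto simp: PiE_def dest: circuit_entry)
    then show "c \<in> vec_lambda ` (UNIV \<rightarrow>\<^sub>E {-1, 0, 1})" by (metis imageI vec_nth_inverse)
  qed
  then show ?thesis by (rule finite_subset) (intro finite_imageI finite_PiE, auto)
qed

lemma circuit_inner: "c \<in> C \<Longrightarrow> c \<bullet> c = l1 c"
  by (rule l1_eq_inner_self[symmetric]) (rule circuit_entry)

text \<open>Subtracting the largest multiple of a conforming circuit that flips no sign kills a
  coordinate, so the support shrinks. The sign condition in \<open>step\<close> records that the sum
  has no cancellation, which is what makes \<open>l1\<close> additive along it.\<close>

lemma conformal_induct [consumes 1, case_names zero step]:
  assumes "x \<in> W" "P 0"
    and step: "\<And>c y t. c \<in> C \<Longrightarrow> y \<in> W \<Longrightarrow> 0 < t \<Longrightarrow> (\<And>e. 0 \<le> c $ e * y $ e) \<Longrightarrow> P y \<Longrightarrow> P (y + t *\<^sub>R c)"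
  shows "P x"
  using \<open>x \<in> W\<close>
proof (induct "card {e. x $ e \<noteq> 0}" arbitrary: x rule: less_induct)
  case less
  show ?case
  proof (cases "x = 0")
    case True then show ?thesis using \<open>P 0\<close> by simp
  next
    case False
    obtain c where c: "c \<in> C" "conforms c x" using circuit_conforming[OF less(2) False] by blast
    define E where "E = {e. c $ e \<noteq> 0}"
    have "E \<noteq> {}" using circuit_nonzero[OF c(1)] by (auto simp: E_def vec_eq_iff)
    define t where "t = Min ((\<lambda>e. \<bar>x $ e\<bar>) ` E)"
    have "t \<in> (\<lambda>e. \<bar>x $ e\<bar>) ` E" unfolding t_def using \<open>E \<noteq> {}\<close> by (intro Min_in) auto
    then obtain e0 where e0: "e0 \<in> E" "t = \<bar>x $ e0\<bar>" by auto
    have t_le: "t \<le> \<bar>x $ e\<bar>" if "e \<in> E" for e using that by (auto simp: t_def)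
    have xE: "x $ e \<noteq> 0" if "e \<in> E" for e using that c(2) by (auto simp: conforms_def E_def)
    have "0 < t" using e0 xE by auto
    define y where "y = x - t *\<^sub>R c"
    have y: "y \<in> W" unfolding y_def by (intro W_diff W_scale circuit_in[OF c(1)] less(2))
    have cx: "x $ e = c $ e * \<bar>x $ e\<bar>" if "e \<in> E" for e
      using that c(2) by (cases rule: circuit_cases[OF c(1), of e]) (auto simp: conforms_def E_def dest!: spec[of _ e])
    have cy: "0 \<le> c $ e * y $ e" for e
    proof (cases "e \<in> E")
      case True
      then show ?thesis using t_le[OF True] cx[OF True]
        by (cases rule: circuit_cases[OF c(1), of e]) (auto simp: y_def)
    qed (simp add: E_def)
    have "y $ e0 = 0" using cx[OF e0(1)] e0(2) by (simp add: y_def algebra_simps)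
    have "{e. y $ e \<noteq> 0} \<subseteq> {e. x $ e \<noteq> 0}" using xE by (auto simp: y_def E_def)
    then have "{e. y $ e \<noteq> 0} \<subset> {e. x $ e \<noteq> 0}" using \<open>y $ e0 = 0\<close> xE[OF e0(1)] by auto
    then have "P y" using y by (intro less(1) psubset_card_mono) auto
    then have "P (y + t *\<^sub>R c)" using c(1) y \<open>0 < t\<close> cy by (intro step)
    then show ?thesis by (simp add: y_def)
  qed
qed

text \<open>The axiom only yields some conforming circuit. In a sum without cancellation every
  summand conforms to the total, and one of them is nonzero at \<open>e\<close>.\<close>

lemma conforming_circuit_through:
  assumes "x \<in> W" "x $ e \<noteq> 0"
  shows "\<exists>c\<in>C. conforms c x \<and> c $ e \<noteq> 0"
  using assms
proof (induct rule: conformal_induct)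
  case (step c y t)
  show ?case
  proof (cases "c $ e = 0")
    case True
    with step obtain d where d: "d \<in> C" "conforms d y" "d $ e \<noteq> 0" by auto
    have "0 < d $ f * (y + t *\<^sub>R c) $ f" if "d $ f \<noteq> 0" for f
    proof -
      have "0 < d $ f * y $ f" using d(2) that by (auto simp: conforms_def)
      moreover have "0 \<le> d $ f * c $ f"
        using \<open>0 < d $ f * y $ f\<close> step(4)[of f] by (auto simp: zero_le_mult_iff zero_less_mult_iff)
      ultimately show ?thesis using \<open>0 < t\<close>
        by (simp add: algebra_simps) (metis add_pos_nonneg less_imp_le mult.left_commute mult_nonneg_nonneg)
    qed
    then show ?thesis using d by (auto simp: conforms_def)
  next
    case False
    have "0 < c $ f * (y + t *\<^sub>R c) $ f" if "c $ f \<noteq> 0" for f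
    proof -
      have "0 < t * (c $ f * c $ f)" using that \<open>0 < t\<close> by (auto simp: zero_less_mult_iff)
      then show ?thesis using step(4)[of f] by (simp add: algebra_simps)
    qed
    then show ?thesis using step(1) False by (auto simp: conforms_def)
  qed
qed simp

lemma ground_unit:
  assumes "e \<in> ground W"
  shows "\<exists>x\<in>W. x $ e = 1 \<and> (\<forall>f. x $ f \<in> {-1, 0, 1})"
proof -
  obtain c where c: "c \<in> C" "c $ e \<noteq> 0"
    using assms conforming_circuit_through[of _ e] by (auto simp: ground_def)
  show ?thesis
  proof (cases rule: circuit_cases[OF c(1), of e])
    case 1
    then show ?thesis using c circuit_in circuit_entry by blast
  next
    case 2
    have "(- c) $ f \<in> {-1, 0, 1}" for f by (cases rule: circuit_cases[OF c(1), of f]) auto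
    then show ?thesis using 2 W_minus[OF circuit_in[OF c(1)]] by (intro bexI[of _ "- c"]) auto
  qed (use c in simp)
qed

text \<open>One-sided vanishing suffices. For \<open>u\<close> with \<open>u $ a = 1\<close>, the
  vector \<open>x - (x $ a) *\<^sub>R u\<close> vanishes at \<open>a\<close>, hence at
  \<open>f\<close>; so the ratio is \<open>u $ f\<close>, and unimodularity makes it a sign.\<close>

lemma vanishing_imp_signed:
  assumes a: "a \<in> ground W" and f: "f \<in> ground W"
    and van: "\<And>x. x \<in> W \<Longrightarrow> x $ a = 0 \<Longrightarrow> x $ f = 0"
  shows "\<exists>s\<in>{-1, 1}. \<forall>x\<in>W. x $ f = s * x $ a"
proof -
  obtain u where u: "u \<in> W" "u $ a = 1" "\<And>f. u $ f \<in> {-1, 0, 1}" using ground_unit[OF a] by blast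
  have eq: "x $ f = u $ f * x $ a" if "x \<in> W" for x
    using van[of "x - (x $ a) *\<^sub>R u"] u that by (simp add: W_diff W_scale)
  have "u $ f \<noteq> 0" using f eq by (auto simp: ground_def)
  then show ?thesis using u(3)[of f] eq by auto
qed

lemma vanishing_imp_parallel:
  assumes "a \<in> ground W" "f \<in> ground W" "\<And>x. x \<in> W \<Longrightarrow> x $ a = 0 \<Longrightarrow> x $ f = 0"
  shows "parallel_in W f a"
proof -
  obtain s where "s \<in> {-1, 1::real}" "\<forall>x\<in>W. x $ f = s * x $ a"
    using vanishing_imp_signed[of a f] assms by blast
  then show ?thesis by (auto simp: parallel_in_def)
qed

lemma parallel_in_signed:
  assumes "a \<in> ground W" "parallel_in W f a"
  shows "\<exists>s\<in>{-1, 1}. \<forall>x\<in>W. x $ f = s * x $ a"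
  using assms parallel_in_ground[of W f a] by (intro vanishing_imp_signed) (auto simp: parallel_in_def)

text \<open>A circuit conforming to x has its support inside that of x. It therefore avoids
  \<open>e\<close> whenever x does, and the old circuits avoiding \<open>e\<close> are
  enough.\<close>

lemma regular_space_delete: "regular_space (W \<inter> {x. x $ e = 0}) {c\<in>C. c $ e = 0}"
proof
  have "subspace {x :: real ^ 'e. x $ e = 0}" by (auto simp: subspace_def)
  then show "subspace (W \<inter> {x. x $ e = 0})" using subspace_W by (rule subspace_inter[rotated])
next
  fix x assume x: "x \<in> W \<inter> {x. x $ e = 0}" "x \<noteq> 0"
  then obtain c where c: "c \<in> C" "conforms c x" using circuit_conforming[of x] by auto
  then have "c $ e = 0" using x by (force simp: conforms_def)
  then show "\<exists>c\<in>{c\<in>C. c $ e = 0}. conforms c x" using c by blast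
qed (use circuit_in circuit_nonzero circuit_entry circuit_elementary in blast)+

lemma ground_delete:
  assumes "e \<in> ground W" "f \<in> ground W" "\<not> parallel_in W f e"
  shows "f \<in> ground (W \<inter> {x. x $ e = 0})"
  using vanishing_imp_parallel[of e f] assms by (auto simp: ground_def)

end

lemma card_ground_delete:
  assumes "e \<in> ground W"
  shows "card (ground (W \<inter> {x. x $ e = 0})) < card (ground W)"
  using assms by (intro psubset_card_mono) (auto simp: ground_def)

section \<open>Linear independence of the squared coordinates\<close>

context regular_space
begin

text \<open>After deletion \<open>f\<close> is a signed copy of \<open>a\<close>. Because
  \<open>a\<close> and \<open>e\<close> are not parallel, some unimodular \<open>u\<close> vanishes
  at \<open>a\<close> and is 1 at \<open>e\<close>. Subtracting \<open>(x $ e) *\<^sub>R u\<close>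
  moves x into the deletion without changing its value at \<open>a\<close>, so the coefficient of
  \<open>x $ e\<close> is \<open>u $ f\<close>.\<close>

lemma parallel_after_delete:
  assumes a: "a \<in> ground W" and e: "e \<in> ground W" and ae: "\<not> parallel_in W a e"
    and fa: "parallel_in (W \<inter> {x. x $ e = 0}) f a"
  shows "\<exists>s\<in>{-1, 1}. \<exists>t\<in>{-1, 0, 1}. \<forall>x\<in>W. x $ f = s * x $ a + t * x $ e"
proof -
  interpret D: regular_space "W \<inter> {x. x $ e = 0}" "{c\<in>C. c $ e = 0}" by (rule regular_space_delete)
  obtain s where s: "s \<in> {-1, 1::real}" "\<And>x. x \<in> W \<Longrightarrow> x $ e = 0 \<Longrightarrow> x $ f = s * x $ a"
    using D.parallel_in_signed[OF ground_delete[OF e a ae] fa] by blast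
  interpret A: regular_space "W \<inter> {x. x $ a = 0}" "{c\<in>C. c $ a = 0}" by (rule regular_space_delete)
  have "e \<in> ground (W \<inter> {x. x $ a = 0})" using a e ae parallel_in_sym by (intro ground_delete) auto
  then obtain u where u: "u \<in> W" "u $ a = 0" "u $ e = 1" "u $ f \<in> {-1, 0, 1}"
    using A.ground_unit by blast
  have "x $ f = s * x $ a + u $ f * x $ e" if "x \<in> W" for x
    using s(2)[of "x - (x $ e) *\<^sub>R u"] u that by (simp add: W_diff W_scale algebra_simps)
  then show ?thesis using s u(4) by blast
qed

text \<open>Up to sign, \<open>b\<close> is one of x_a + x_e and x_a - x_e. A further class merging
  with that of \<open>a\<close> would have to be the other one, and the two together contradict
  unimodularity.\<close>

lemma parallel_after_delete_class:
  assumes a: "a \<in> ground W" and e: "e \<in> ground W" and ae: "\<not> parallel_in W a e"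
    and st: "s \<in> {-1, 1::real}" "t \<in> {-1, 1::real}"
    and eq: "\<forall>x\<in>W. x $ b = s * x $ a + t * x $ e"
  shows "{f. parallel_in (W \<inter> {x. x $ e = 0}) f a} = {f. parallel_in W f a} \<union> {f. parallel_in W f b}"
    and "{f. parallel_in W f a} \<inter> {f. parallel_in W f b} = {}"
    and "b \<in> ground W"
    and "\<not> parallel_in W b a"
proof -
  note b = eq[rule_format]
  have ba: "\<not> parallel_in W b a"
  proof
    assume "parallel_in W b a"
    then have "x $ e = 0" if "x \<in> W" "x $ a = 0" for x
      using b[OF that(1)] that st by (auto simp: parallel_in_def)
    then show False using vanishing_imp_parallel[of a e] a e ae parallel_in_sym by blast
  qed
  then show "\<not> parallel_in W b a" .
  then show "{f. parallel_in W f a} \<inter> {f. parallel_in W f b} = {}"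
    using parallel_in_sym parallel_in_trans by blast
  obtain u where "u \<in> W" "u $ e = 0" "u $ a \<noteq> 0" using ground_delete[OF e a ae] by (auto simp: ground_def)
  then have "u $ b \<noteq> 0" using b[of u] st by auto
  then show bg: "b \<in> ground W" using \<open>u \<in> W\<close> by (auto simp: ground_def)
  have "parallel_in W f a \<or> parallel_in W f b" if f: "parallel_in (W \<inter> {x. x $ e = 0}) f a" for f
  proof (rule ccontr)
    assume np: "\<not> (parallel_in W f a \<or> parallel_in W f b)"
    obtain s' t' where s': "s' \<in> {-1, 1::real}" "t' \<in> {-1, 0, 1::real}"
      and f': "\<And>x. x \<in> W \<Longrightarrow> x $ f = s' * x $ a + t' * x $ e"
      using parallel_after_delete[OF a e ae f] by blast
    have "t' \<noteq> 0" using np f' s' by (auto simp: parallel_in_def)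
    have fg: "f \<in> ground W" using np f' s'(1) \<open>u \<in> W\<close> \<open>u $ e = 0\<close> \<open>u $ a \<noteq> 0\<close>
      by (auto simp: ground_def intro!: bexI[of _ u])
    interpret F: regular_space "W \<inter> {x. x $ f = 0}" "{c\<in>C. c $ f = 0}" by (rule regular_space_delete)
    have "b \<in> ground (W \<inter> {x. x $ f = 0})" using np parallel_in_sym by (intro ground_delete fg bg) blast
    then obtain v where v: "v \<in> W" "v $ f = 0" "v $ b = 1" "v $ a \<in> {-1, 0, 1}" "v $ e \<in> {-1, 0, 1}"
      using F.ground_unit by blast
    have "parallel_in W f b" if "s' * t' = s * t"
    proof -
      have "x $ f = s' * s * x $ b" if "x \<in> W" for x
        using f'[OF that] b[OF that] st s' \<open>s' * t' = s * t\<close> by auto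
      then show ?thesis using st s' by (auto simp: parallel_in_def)
    qed
    then have "s' * t' \<noteq> s * t" using np by blast
    \<comment> \<open>Here \<open>s' * t' = - s * t\<close>, so \<open>v $ f = 0\<close> gives
      \<open>v $ b = 2 * t * v $ e\<close>, an even integer, which cannot be 1.\<close>
    then show False using f'[OF v(1)] b[OF v(1)] v st s' \<open>t' \<noteq> 0\<close> by auto
  qed
  moreover have "parallel_in (W \<inter> {x. x $ e = 0}) f a" if "parallel_in W f a \<or> parallel_in W f b" for f
    using that b st by (auto simp: parallel_in_def)
  ultimately show "{f. parallel_in (W \<inter> {x. x $ e = 0}) f a} = {f. parallel_in W f a} \<union> {f. parallel_in W f b}"
    by blast
qed

end

text \<open>
  Deleting an edge either keeps a parallel class or merges it with exactly one other class,
  the third one on the line spanned by the two. If the class sum at \<open>a\<close> did not vanish, all three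
  pairs on such a line would have class sums adding up to zero.
\<close>

lemma squares_independent:
  fixes d :: "'e::finite \<Rightarrow> real"
  assumes "regular_space W C"
    and "\<And>x y. x \<in> W \<Longrightarrow> y \<in> W \<Longrightarrow> (\<Sum>e\<in>UNIV. d e * x $ e * y $ e) = 0"
    and "a \<in> ground W"
  shows "(\<Sum>f | parallel_in W f a. d f) = 0"
  using assms
proof (induct "card (ground W)" arbitrary: W C a rule: less_induct)
  case less
  interpret regular_space W C by fact
  note a = \<open>a \<in> ground W\<close> and Q = less(3)
  have del: "(\<Sum>f | parallel_in (W \<inter> {x. x $ e = 0}) f a. d f) = 0"
    if "e \<in> ground W" "a \<in> ground W" "\<not> parallel_in W a e" for e a
    using that by (intro less(1)[OF card_ground_delete regular_space_delete] Q ground_delete) auto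
  have pair: "(\<Sum>f | parallel_in W f a. d f) + (\<Sum>f | parallel_in W f b. d f) = 0"
    if "a \<in> ground W" "e \<in> ground W" "\<not> parallel_in W a e" "s \<in> {-1, 1::real}" "t \<in> {-1, 1::real}"
      "\<forall>x\<in>W. x $ b = s * x $ a + t * x $ e" for a b e s t
  proof -
    note cl = parallel_after_delete_class[OF that]
    have "0 = (\<Sum>f | parallel_in (W \<inter> {x. x $ e = 0}) f a. d f)" using del[of e a] that by simp
    also have "\<dots> = (\<Sum>f | parallel_in W f a. d f) + (\<Sum>f | parallel_in W f b. d f)"
      unfolding cl(1) by (rule sum.union_disjoint) (use cl(2) in auto)
    finally show ?thesis by simp
  qed
  show ?case
  proof (cases "\<forall>e\<in>ground W. parallel_in W e a")
    case True
    obtain u where u: "u \<in> W" "u $ a = 1" "\<forall>f. u $ f \<in> {-1, 0, 1}" using ground_unit[OF a] by blast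
    \<comment> \<open>With a single class, \<open>u\<close> is a signed indicator of it, and the
      form at (u, u) is the class sum.\<close>
    have "u $ e * u $ e = (if parallel_in W e a then 1 else 0)" for e
    proof (cases "parallel_in W e a")
      case True
      then have "u $ e \<noteq> 0" using u by (auto simp: parallel_in_def)
      then show ?thesis using u(3)[rule_format, of e] True by auto
    next
      case False
      then have "u $ e = 0" using \<open>\<forall>e\<in>ground W. parallel_in W e a\<close> u(1) by (auto simp: ground_def)
      then show ?thesis using False by simp
    qed
    then have "(\<Sum>e\<in>UNIV. d e * u $ e * u $ e) = (\<Sum>e\<in>UNIV. if parallel_in W e a then d e else 0)"
      by (intro sum.cong) (auto simp: mult.assoc)
    then show ?thesis using Q[OF u(1) u(1)] by (simp add: sum.If_cases)
  next
    case False
    then obtain e where e: "e \<in> ground W" "\<not> parallel_in W e a" by blast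
    then have ae: "\<not> parallel_in W a e" using parallel_in_sym by blast
    show ?thesis
    proof (cases "{f. parallel_in (W \<inter> {x. x $ e = 0}) f a} = {f. parallel_in W f a}")
      case True
      then show ?thesis using del[OF e(1) a ae] by simp
    next
      case False
      then obtain b where b: "parallel_in (W \<inter> {x. x $ e = 0}) b a" "\<not> parallel_in W b a"
        unfolding parallel_in_def by blast
      obtain s t where st: "s \<in> {-1, 1::real}" "t \<in> {-1, 0, 1::real}"
        and eq: "\<forall>x\<in>W. x $ b = s * x $ a + t * x $ e"
        using parallel_after_delete[OF a e(1) ae b(1)] by blast
      have "t \<noteq> 0" using b(2) eq st(1) by (auto simp: parallel_in_def)
      then have t: "t \<in> {-1, 1}" using st(2) by auto
      note cl = parallel_after_delete_class[OF a e(1) ae st(1) t eq]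
      have 1: "(\<Sum>f | parallel_in W f a. d f) + (\<Sum>f | parallel_in W f b. d f) = 0"
        using pair[OF a e(1) ae st(1) t eq] by simp
      have ab: "\<not> parallel_in W a b" using b(2) parallel_in_sym by blast
      \<comment> \<open>The relation is symmetric in the three classes because \<open>s\<close> and
        \<open>t\<close> are signs: deleting \<open>b\<close> merges \<open>a\<close> with
        \<open>e\<close>, and deleting \<open>a\<close> merges \<open>e\<close> with
        \<open>b\<close>.\<close>
      have 2: "(\<Sum>f | parallel_in W f a. d f) + (\<Sum>f | parallel_in W f e. d f) = 0"
      proof (rule pair[OF a cl(3) ab])
        show "- s * t \<in> {-1, 1}" "t \<in> {-1, 1}" using st(1) t by auto
        show "\<forall>x\<in>W. x $ e = - s * t * x $ a + t * x $ b"
          using eq st(1) t by auto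
      qed
      have 3: "(\<Sum>f | parallel_in W f e. d f) + (\<Sum>f | parallel_in W f b. d f) = 0"
      proof (rule pair[OF e(1) a e(2)])
        show "t \<in> {-1, 1}" "s \<in> {-1, 1}" using st(1) t by auto
        show "\<forall>x\<in>W. x $ b = t * x $ e + s * x $ a"
          using eq by simp
      qed
      show ?thesis using 1 2 3 by linarith
    qed
  qed
qed

section \<open>The facets of the Voronoi cell\<close>

lemma finite_uniform_delta:
  fixes P :: "'a \<Rightarrow> real \<Rightarrow> bool"
  assumes "finite A" "\<And>a. a \<in> A \<Longrightarrow> \<exists>\<delta>>0. \<forall>s. \<bar>s\<bar> \<le> \<delta> \<longrightarrow> P a s"
  shows "\<exists>\<delta>>0. \<forall>s. \<bar>s\<bar> \<le> \<delta> \<longrightarrow> (\<forall>a\<in>A. P a s)"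
  using assms
proof (induct A)
  case empty
  show ?case by (intro exI[of _ 1]) auto
next
  case (insert a A)
  obtain \<delta> where "\<delta> > 0" "\<forall>s. \<bar>s\<bar> \<le> \<delta> \<longrightarrow> P a s" using insert by blast
  moreover obtain \<delta>' where "\<delta>' > 0" "\<forall>s. \<bar>s\<bar> \<le> \<delta>' \<longrightarrow> (\<forall>a\<in>A. P a s)" using insert by blast
  ultimately show ?case by (intro exI[of _ "min \<delta> \<delta>'"]) auto
qed

lemma voronoi_cell_iff:
  "x \<in> voronoi_cell L \<longleftrightarrow> x \<in> span L \<and> (\<forall>v\<in>L. x \<bullet> v \<le> (v \<bullet> v) / 2)"
proof -
  have "x \<bullet> x \<le> (x - v) \<bullet> (x - v) \<longleftrightarrow> x \<bullet> v \<le> (v \<bullet> v) / 2" for v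
    by (auto simp: inner_diff inner_commute)
  then show ?thesis by (simp add: voronoi_cell_def)
qed

section \<open>The cell of a regular subspace: support function and facets\<close>

context regular_space
begin

definition lattice :: "(real ^ 'e) set" where
  "lattice = {x\<in>W. \<forall>e. x $ e \<in> \<int>}"

abbreviation cell :: "(real ^ 'e) set" where
  "cell \<equiv> voronoi_cell lattice"

abbreviation circuit_face :: "real ^ 'e \<Rightarrow> (real ^ 'e) set" where
  "circuit_face c \<equiv> voronoi_face lattice c"

lemma circuit_lattice: "c \<in> C \<Longrightarrow> c \<in> lattice"
  unfolding lattice_def
proof safe
  fix e assume "c \<in> C"
  then show "c $ e \<in> \<int>" by (cases rule: circuit_cases[of c e]) auto
qed (rule circuit_in)

lemma span_lattice: "span lattice = W"
proof
  show "span lattice \<subseteq> W" by (rule span_minimal) (auto simp: lattice_def subspace_W)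
  show "W \<subseteq> span lattice"
  proof
    fix x assume "x \<in> W"
    then show "x \<in> span lattice"
      by (induct rule: conformal_induct)
        (auto intro!: span_add span_scale span_zero intro: span_base circuit_lattice)
  qed
qed

text \<open>Integers satisfy |k| \<le> k * k, with equality only at -1, 0, 1. So a bound by
  \<open>l1 v / 2\<close> implies the Voronoi inequality of \<open>v\<close>, and the case of
  equality singles out the lattice vectors that can define facets.\<close>

lemma l1_le_inner_self:
  assumes "v \<in> lattice"
  shows "l1 v \<le> v \<bullet> v" and "l1 v = v \<bullet> v \<Longrightarrow> v $ e \<in> {-1, 0, 1}"
proof -
  have le: "\<bar>v $ e\<bar> \<le> v $ e * v $ e \<and> (\<bar>v $ e\<bar> = v $ e * v $ e \<longrightarrow> v $ e \<in> {-1, 0, 1})" for e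
  proof -
    obtain k where k: "v $ e = of_int k" using assms by (auto simp: lattice_def elim: Ints_cases)
    have "\<bar>k\<bar> * 1 \<le> \<bar>k\<bar> * \<bar>k\<bar>" by (cases "k = 0", simp) (intro mult_left_mono, auto)
    then have 1: "\<bar>k\<bar> \<le> k * k" by simp
    have "k \<in> {-1, 0, 1}" if "\<bar>k\<bar> = k * k"
    proof -
      have "\<bar>k\<bar> * \<bar>k\<bar> = \<bar>k\<bar> * 1" using that by (metis abs_mult_self_eq mult_1_right)
      then have "k = 0 \<or> \<bar>k\<bar> = 1" by (metis abs_eq_0 mult_cancel_left)
      then show ?thesis by auto
    qed
    with 1 show ?thesis unfolding k
      by (auto simp flip: of_int_abs of_int_mult)
  qed
  then show "l1 v \<le> v \<bullet> v" unfolding l1_def inner_vec_def by (intro sum_mono) simp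
  assume "l1 v = v \<bullet> v"
  then have "(\<Sum>e\<in>UNIV. v $ e * v $ e - \<bar>v $ e\<bar>) = 0"
    by (simp add: l1_def inner_vec_def sum_subtractf)
  then have "\<forall>e\<in>UNIV. v $ e * v $ e - \<bar>v $ e\<bar> = 0"
    by (subst (asm) sum_nonneg_eq_0_iff) (use le in auto)
  then show "v $ e \<in> {-1, 0, 1}" using le[of e] by auto
qed

text \<open>
  The bound \<open>l1 v / 2\<close> is the support function of the projection of the cube with vertices
  \<open>\<plusminus>1/2\<close> onto \<open>W\<close>, so the cell is a zonotope.
\<close>

lemma cell_iff_circuits: "x \<in> cell \<longleftrightarrow> x \<in> W \<and> (\<forall>c\<in>C. x \<bullet> c \<le> (c \<bullet> c) / 2)"
  and cell_iff_l1: "x \<in> cell \<longleftrightarrow> x \<in> W \<and> (\<forall>v\<in>W. x \<bullet> v \<le> l1 v / 2)"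
proof -
  have 1: "x \<in> W \<and> (\<forall>c\<in>C. x \<bullet> c \<le> (c \<bullet> c) / 2)" if "x \<in> cell"
    using that circuit_lattice by (auto simp: voronoi_cell_iff span_lattice)
  have 2: "x \<bullet> v \<le> l1 v / 2" if C: "\<forall>c\<in>C. x \<bullet> c \<le> (c \<bullet> c) / 2" and v: "v \<in> W" for v
    using v
  proof (induct rule: conformal_induct)
    case (step c y t)
    have "0 \<le> y $ e * (t *\<^sub>R c) $ e" for e
      using mult_nonneg_nonneg[OF less_imp_le[OF step(3)] step(4)[of e]] by (simp add: mult_ac)
    \<comment> \<open>Without cancellation \<open>l1\<close> is additive, so the inequalities of the
      circuits add up to that of the whole vector.\<close>
    then have "l1 (y + t *\<^sub>R c) = l1 y + t * l1 c"
      using step(3) by (subst l1_add_eq_iff[THEN iffD2]) (auto simp: l1_scaleR)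
    moreover have "t * (x \<bullet> c) \<le> t * (l1 c / 2)"
      using C step(1,3) circuit_inner[OF step(1)] by (intro mult_left_mono) auto
    ultimately show ?case using step(5) by (simp add: inner_add_right)
  qed simp
  have 3: "x \<in> cell" if "x \<in> W" "\<forall>v\<in>W. x \<bullet> v \<le> l1 v / 2"
    unfolding voronoi_cell_iff span_lattice
  proof (intro conjI ballI)
    fix v assume v: "v \<in> lattice"
    then have "x \<bullet> v \<le> l1 v / 2" using that(2) by (auto simp: lattice_def)
    then show "x \<bullet> v \<le> (v \<bullet> v) / 2" using l1_le_inner_self(1)[OF v] by linarith
  qed (rule that)
  show "x \<in> cell \<longleftrightarrow> x \<in> W \<and> (\<forall>c\<in>C. x \<bullet> c \<le> (c \<bullet> c) / 2)" using 1 2 3 by blast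
  show "x \<in> cell \<longleftrightarrow> x \<in> W \<and> (\<forall>v\<in>W. x \<bullet> v \<le> l1 v / 2)" using 1 2 3 by blast
qed

lemma cell_subset: "cell \<subseteq> W"
  using cell_iff_circuits by blast

lemma polyhedron_cell: "polyhedron cell"
proof -
  have "cell = W \<inter> \<Inter> ((\<lambda>c. {x. c \<bullet> x \<le> (c \<bullet> c) / 2}) ` C)"
    by (auto simp: cell_iff_circuits inner_commute)
  moreover have "polyhedron \<dots>"
    by (intro polyhedron_Int polyhedron_Inter affine_imp_polyhedron[OF subspace_imp_affine[OF subspace_W]])
      (use polyhedron_halfspace_le finite_C in blast)+
  ultimately show ?thesis by simp
qed

lemma convex_cell: "convex cell"
  using polyhedron_cell by (rule polyhedron_imp_convex)

lemma small_in_cell: "x \<in> W \<Longrightarrow> (\<And>e. \<bar>x $ e\<bar> \<le> 1/2) \<Longrightarrow> x \<in> cell"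
  unfolding cell_iff_l1 using inner_le_l1 by blast

text \<open>The exposed face in direction \<open>v\<close>, for every \<open>v\<close> in
  \<open>W\<close> and not only for circuits: the faces of small dimension are exposed by sums of
  circuits.\<close>

definition support_face :: "real ^ 'e \<Rightarrow> (real ^ 'e) set" where
  "support_face v = {x\<in>cell. x \<bullet> v = l1 v / 2}"

lemma support_face_face_of: "v \<in> W \<Longrightarrow> support_face v face_of cell"
proof -
  assume "v \<in> W"
  then have "(cell \<inter> {x. v \<bullet> x = l1 v / 2}) face_of cell"
    by (intro face_of_Int_supporting_hyperplane_le convex_cell) (auto simp: cell_iff_l1 inner_commute)
  moreover have "cell \<inter> {x. v \<bullet> x = l1 v / 2} = support_face v"
    by (auto simp: support_face_def inner_commute)
  ultimately show ?thesis by simp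
qed

lemma circuit_face_eq: "c \<in> C \<Longrightarrow> circuit_face c = support_face c"
  by (auto simp: voronoi_face_def support_face_def circuit_inner)

text \<open>Tight inequalities stay constant along \<open>u\<close>, and the finitely many slack
  ones survive a small move in either direction.\<close>

lemma cell_perturb:
  assumes x: "x \<in> cell" and u: "u \<in> W"
    and tight: "\<And>c. c \<in> C \<Longrightarrow> x \<bullet> c = (c \<bullet> c) / 2 \<Longrightarrow> u \<bullet> c = 0"
  shows "\<exists>\<delta>>0. \<forall>s. \<bar>s\<bar> \<le> \<delta> \<longrightarrow> x + s *\<^sub>R u \<in> cell"
proof -
  have "\<exists>\<delta>>0. \<forall>s. \<bar>s\<bar> \<le> \<delta> \<longrightarrow> (\<forall>c\<in>C. (x + s *\<^sub>R u) \<bullet> c \<le> (c \<bullet> c) / 2)"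
  proof (rule finite_uniform_delta[OF finite_C])
    fix c assume c: "c \<in> C"
    show "\<exists>\<delta>>0. \<forall>s. \<bar>s\<bar> \<le> \<delta> \<longrightarrow> (x + s *\<^sub>R u) \<bullet> c \<le> (c \<bullet> c) / 2"
    proof (cases "x \<bullet> c = (c \<bullet> c) / 2")
      case True
      then show ?thesis using tight[OF c] by (intro exI[of _ 1]) (simp add: inner_add_left)
    next
      case False
      define g where "g = (c \<bullet> c) / 2 - x \<bullet> c"
      have "0 < g" using False x c by (auto simp: g_def cell_iff_circuits less_le)
      \<comment> \<open>The summand 1 keeps the denominator positive when \<open>u\<close> is
        orthogonal to \<open>c\<close>.\<close>
      have "s * (u \<bullet> c) \<le> g" if "\<bar>s\<bar> \<le> g / (\<bar>u \<bullet> c\<bar> + 1)" for s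
      proof -
        have "s * (u \<bullet> c) \<le> \<bar>s\<bar> * \<bar>u \<bullet> c\<bar>" by (metis abs_ge_self abs_mult)
        also have "\<dots> \<le> \<bar>s\<bar> * (\<bar>u \<bullet> c\<bar> + 1)" by (intro mult_left_mono) auto
        also have "\<dots> \<le> g" using that by (simp add: pos_le_divide_eq)
        finally show ?thesis .
      qed
      then show ?thesis using \<open>0 < g\<close>
        by (intro exI[of _ "g / (\<bar>u \<bullet> c\<bar> + 1)"]) (fastforce simp: inner_add_left g_def)
    qed
  qed
  then show ?thesis using x u by (auto simp: cell_iff_circuits W_add W_scale)
qed

text \<open>Coordinatewise c_e v_e \<le> v_e v_e, so equal inner products force \<open>c\<close> to
  coincide with \<open>v\<close> on the support of \<open>v\<close>. That support lies in the one of
  \<open>c\<close>, and minimality leaves only \<open>v = c\<close>.\<close>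

lemma conforming_circuit_eq:
  assumes "c \<in> C" "v \<in> W" "v \<noteq> 0" "\<And>e. v $ e \<in> {-1, 0, 1}" "c \<bullet> v = v \<bullet> v"
  shows "v = c"
proof -
  have le: "c $ e * v $ e \<le> v $ e * v $ e" for e
    using assms(4)[of e] by (cases rule: circuit_cases[OF assms(1), of e]) auto
  have "(\<Sum>e\<in>UNIV. v $ e * v $ e - c $ e * v $ e) = 0"
    using assms(5) by (simp add: inner_vec_def sum_subtractf)
  then have "\<forall>e\<in>UNIV. v $ e * v $ e - c $ e * v $ e = 0"
    by (subst (asm) sum_nonneg_eq_0_iff) (use le in auto)
  then have eq: "c $ e = v $ e" if "v $ e \<noteq> 0" for e using that by (metis UNIV_I eq_iff_diff_eq_0 mult_cancel_right)
  then obtain t where t: "v = t *\<^sub>R c" using circuit_elementary[OF assms(1,2)] by metis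
  obtain e where "v $ e \<noteq> 0" using assms(3) by (auto simp: vec_eq_iff)
  then have "t = 1" using eq[of e] t by simp
  then show ?thesis using t by simp
qed

lemma half_circuit_in_face:
  assumes "c \<in> C"
  shows "(1/2) *\<^sub>R c \<in> circuit_face c"
proof -
  have "\<bar>((1/2) *\<^sub>R c) $ e\<bar> \<le> 1/2" for e
    by (cases rule: circuit_cases[OF assms, of e]) auto
  then have "(1/2) *\<^sub>R c \<in> cell" using assms by (intro small_in_cell W_scale circuit_in)
  then show ?thesis by (simp add: voronoi_face_def)
qed

text \<open>Makes \<open>c / 2\<close> a witness for the facet of \<open>c\<close>: no other circuit
  inequality is tight there. This distinguishes the facets and allows perturbation in all directions
  orthogonal to \<open>c\<close>.\<close>

lemma half_circuit_tight:
  assumes "c \<in> C" "d \<in> C" "((1/2) *\<^sub>R c) \<bullet> d = (d \<bullet> d) / 2"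
  shows "d = c"
  using assms circuit_in[OF assms(2)] circuit_nonzero[OF assms(2)] circuit_entry[OF assms(2)]
  by (intro conforming_circuit_eq) auto

lemma circuit_face_inject:
  assumes "c \<in> C" "d \<in> C" "circuit_face c = circuit_face d"
  shows "c = d"
proof -
  have "(1/2) *\<^sub>R c \<in> circuit_face d" using half_circuit_in_face[OF assms(1)] assms(3) by simp
  then show ?thesis using half_circuit_tight[OF assms(1,2)] by (simp add: voronoi_face_def)
qed

lemma zero_in_cell: "0 \<in> cell"
  by (rule small_in_cell) auto

text \<open>From \<open>c / 2\<close> one can move inside the face in every direction of
  \<open>W\<close> orthogonal to \<open>c\<close>, which yields codimension at most one; the face is
  proper because it misses 0.\<close>

lemma circuit_face_facet:
  assumes c: "c \<in> C"
  shows "circuit_face c facet_of cell"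
proof -
  let ?F = "circuit_face c"
  have face: "?F face_of cell" using c by (simp add: circuit_face_eq support_face_face_of circuit_in)
  have "0 \<notin> ?F" using circuit_nonzero[OF c] by (auto simp: voronoi_face_def)
  then have "?F \<noteq> cell" using zero_in_cell by blast
  then have lt: "aff_dim ?F < aff_dim cell" using face convex_cell by (intro face_of_aff_dim_lt)
  define T where "T = {y\<in>W. y \<bullet> c = 0}"
  have T: "subspace T" using subspace_W by (auto simp: T_def subspace_def inner_add_left)
  have "(+) ((1/2) *\<^sub>R c) ` T \<subseteq> affine hull ?F"
  proof clarify
    fix y assume y: "y \<in> T"
    have "\<exists>\<delta>>0. \<forall>s. \<bar>s\<bar> \<le> \<delta> \<longrightarrow> (1/2) *\<^sub>R c + s *\<^sub>R y \<in> cell"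
      using y half_circuit_tight[OF c] half_circuit_in_face[OF c]
      by (intro cell_perturb) (auto simp: T_def voronoi_face_def)
    then obtain \<delta> where \<delta>: "\<delta> > 0" "(1/2) *\<^sub>R c + \<delta> *\<^sub>R y \<in> cell" by auto
    then have "(1/2) *\<^sub>R c + \<delta> *\<^sub>R y \<in> ?F" using y by (auto simp: voronoi_face_def T_def inner_add_left)
    \<comment> \<open>Extrapolation by the factor 1/\<delta>: the point \<open>c / 2 + y\<close> may
      leave the cell, but it stays in the affine hull of the face.\<close>
    then have "(1 - 1/\<delta>) *\<^sub>R ((1/2) *\<^sub>R c) + (1/\<delta>) *\<^sub>R ((1/2) *\<^sub>R c + \<delta> *\<^sub>R y) \<in> affine hull ?F"
      using half_circuit_in_face[OF c] by (intro mem_affine[OF affine_affine_hull] hull_inc) auto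
    moreover have "(1 - 1/\<delta>) *\<^sub>R ((1/2) *\<^sub>R c) + (1/\<delta>) *\<^sub>R ((1/2) *\<^sub>R c + \<delta> *\<^sub>R y) = (1/2) *\<^sub>R c + y"
      using \<delta>(1) by (simp add: scaleR_add_right diff_divide_distrib flip: scaleR_left_distrib)
    ultimately show "(1/2) *\<^sub>R c + y \<in> affine hull ?F" by simp
  qed
  then have "aff_dim ((+) ((1/2) *\<^sub>R c) ` T) \<le> aff_dim ?F" by (metis aff_dim_affine_hull aff_dim_subset)
  then have "int (dim T) \<le> aff_dim ?F" using T by (simp add: aff_dim_translation_eq aff_dim_subspace)
  moreover have "W \<subseteq> span (insert c T)"
  proof
    fix x assume "x \<in> W"
    then have "x - ((x \<bullet> c) / (c \<bullet> c)) *\<^sub>R c \<in> T" using circuit_nonzero[OF c] circuit_in[OF c]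
      by (simp add: T_def W_diff W_scale inner_diff_left)
    then have "x - ((x \<bullet> c) / (c \<bullet> c)) *\<^sub>R c \<in> span T" by (rule span_base)
    then show "x \<in> span (insert c T)" unfolding span_insert by blast
  qed
  then have "dim W \<le> dim (insert c T)" by (rule dim_mono)
  then have "dim W \<le> dim T + 1" by (simp add: dim_insert split: if_splits)
  moreover have "aff_dim cell \<le> int (dim W)"
    using aff_dim_subset[OF cell_subset] subspace_W by (simp add: aff_dim_subspace)
  ultimately show ?thesis using lt face half_circuit_in_face[OF c] by (auto simp: facet_of_def)
qed

text \<open>At a relative interior point of \<open>F\<close> some circuit inequality is tight, as
  otherwise \<open>F\<close> would be the whole cell. The face of that circuit contains
  \<open>F\<close> and has the same dimension.\<close>

lemma facet_imp_circuit_face: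
  assumes F: "F facet_of cell"
  shows "\<exists>c\<in>C. F = circuit_face c"
proof -
  have face: "F face_of cell" and "F \<noteq> {}" and ad: "aff_dim F = aff_dim cell - 1"
    using F by (auto simp: facet_of_def)
  then obtain x where x: "x \<in> rel_interior F"
    using rel_interior_eq_empty face_of_imp_convex by blast
  have xF: "x \<in> F" using x rel_interior_subset by blast
  have xcell: "x \<in> cell" using xF face face_of_imp_subset by blast
  have "\<exists>c\<in>C. x \<bullet> c = (c \<bullet> c) / 2"
  proof (rule ccontr)
    assume no: "\<not> (\<exists>c\<in>C. x \<bullet> c = (c \<bullet> c) / 2)"
    \<comment> \<open>With no tight inequality the segment from \<open>z\<close> to \<open>x\<close>
      can be prolonged beyond \<open>x\<close> inside the cell. Then \<open>x\<close> is interior to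
      a segment of the cell, and the face property draws \<open>z\<close> into
      \<open>F\<close>.\<close>
    have "cell \<subseteq> F"
    proof
      fix z assume z: "z \<in> cell"
      have "\<exists>\<delta>>0. \<forall>s. \<bar>s\<bar> \<le> \<delta> \<longrightarrow> x + s *\<^sub>R (x - z) \<in> cell"
        using no xcell z cell_subset by (intro cell_perturb) (auto intro!: W_diff)
      then obtain \<delta> where \<delta>: "\<delta> > 0" "x + \<delta> *\<^sub>R (x - z) \<in> cell" by auto
      show "z \<in> F"
      proof (cases "z = x")
        case False
        have "x = (1 - 1/(1+\<delta>)) *\<^sub>R z + (1/(1+\<delta>)) *\<^sub>R (x + \<delta> *\<^sub>R (x - z))"
        proof -
          have "(1+\<delta>) *\<^sub>R x = (1+\<delta>) *\<^sub>R ((1 - 1/(1+\<delta>)) *\<^sub>R z + (1/(1+\<delta>)) *\<^sub>R (x + \<delta> *\<^sub>R (x - z)))"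
            using \<delta>(1) unfolding scaleR_add_right scaleR_scaleR
            by (simp add: field_simps)
          then show ?thesis using \<delta>(1) by simp
        qed
        moreover have "z \<noteq> x + \<delta> *\<^sub>R (x - z)"
        proof
          assume "z = x + \<delta> *\<^sub>R (x - z)"
          then have "(1 + \<delta>) *\<^sub>R (x - z) = 0" by (simp add: algebra_simps)
          then show False using False \<delta>(1) by simp
        qed
        ultimately have "x \<in> open_segment z (x + \<delta> *\<^sub>R (x - z))"
          unfolding in_segment using \<delta>(1) by (auto intro!: exI[of _ "1/(1+\<delta>)"])
        then show ?thesis using face z \<delta>(2) xF by (auto simp: face_of_def)
      qed (use xF in simp)
    qed
    then show False using ad face face_of_imp_subset by (metis add_cancel_right_right add_diff_cancel_left' diff_add_cancel dual_order.antisym zero_neq_one)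
  qed
  then obtain c where c: "c \<in> C" "x \<bullet> c = (c \<bullet> c) / 2" by blast
  have fc: "circuit_face c face_of cell" using circuit_face_facet[OF c(1)] by (simp add: facet_of_def)
  have sub: "F \<subseteq> circuit_face c"
    using fc face face_of_imp_subset x c xcell
    by (intro subset_of_face_of[OF fc]) (auto simp: disjnt_iff voronoi_face_def)
  have "F face_of circuit_face c" using face sub fc by (meson face_of_imp_subset face_of_subset)
  moreover have "aff_dim F = aff_dim (circuit_face c)"
    using ad circuit_face_facet[OF c(1)] by (simp add: facet_of_def)
  ultimately have "F = circuit_face c"
    using face_of_aff_dim_lt[of "circuit_face c" F] fc face_of_imp_convex by fastforce
  then show ?thesis using c(1) by blast
qed

text \<open>Recognises the circuits among all lattice vectors by the cell alone. If the face of
  \<open>v\<close> is that of a circuit \<open>c\<close>, then \<open>c / 2\<close> is tight for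
  \<open>v\<close>; comparison with the \<open>l1\<close> bound gives
  \<open>l1 v = v \<bullet> v\<close>, so \<open>v\<close> is unimodular and equals
  \<open>c\<close>.\<close>

lemma voronoi_face_facet_iff:
  assumes v: "v \<in> lattice"
  shows "voronoi_face lattice v facet_of cell \<longleftrightarrow> v \<in> C"
proof
  assume F: "voronoi_face lattice v facet_of cell"
  then obtain c where c: "c \<in> C" "voronoi_face lattice v = circuit_face c"
    using facet_imp_circuit_face by blast
  have vW: "v \<in> W" using v by (simp add: lattice_def)
  have half: "(1/2) *\<^sub>R c \<in> cell" "c \<bullet> v = v \<bullet> v"
    using half_circuit_in_face[OF c(1)] unfolding c(2)[symmetric] by (auto simp: voronoi_face_def)
  then have "l1 v = v \<bullet> v" using l1_le_inner_self(1)[OF v] vW by (force simp: cell_iff_l1)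
  then have "v $ e \<in> {-1, 0, 1}" for e using l1_le_inner_self(2)[OF v] by blast
  moreover have "v \<noteq> 0"
  proof
    assume "v = 0"
    then have "voronoi_face lattice v = cell" by (auto simp: voronoi_face_def)
    then show False using F by (simp add: facet_of_def)
  qed
  ultimately have "v = c" using half c(1) vW by (intro conforming_circuit_eq) auto
  then show "v \<in> C" using c(1) by simp
qed (rule circuit_face_facet)

end

section \<open>The edges of the Voronoi cell\<close>

definition has_direction :: "'a::euclidean_space set \<Rightarrow> 'a \<Rightarrow> bool" where
  "has_direction \<epsilon> u \<longleftrightarrow> affine_parallel (affine hull \<epsilon>) (span {u})"

lemma has_direction_unique:
  assumes "has_direction \<epsilon> u" "has_direction \<delta> w"
  shows "affine_parallel (affine hull \<epsilon>) (affine hull \<delta>) \<longleftrightarrow> span {u} = span {w}"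
proof
  assume "affine_parallel (affine hull \<epsilon>) (affine hull \<delta>)"
  then have "affine_parallel (span {u}) (span {w})"
    using assms unfolding has_direction_def by (meson affine_parallel_assoc affine_parallel_commute)
  then show "span {u} = span {w}" by (intro parallel_subspace subspace_span)
next
  assume "span {u} = span {w}"
  then show "affine_parallel (affine hull \<epsilon>) (affine hull \<delta>)"
    using assms unfolding has_direction_def by (metis affine_parallel_assoc affine_parallel_commute)
qed

lemma has_direction_translate:
  assumes "has_direction \<epsilon> u" "x \<in> affine hull \<epsilon>"
  shows "x + u \<in> affine hull \<epsilon>"
proof -
  obtain a where a: "\<And>x. x \<in> affine hull \<epsilon> \<longleftrightarrow> a + x \<in> span {u}"
    using assms(1) unfolding has_direction_def affine_parallel_expl by blast
  have "a + x \<in> span {u}" "u \<in> span {u}" using a assms(2) by (simp_all add: span_base)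
  then have "(a + x) + u \<in> span {u}" by (rule span_add)
  then show ?thesis by (simp add: a add.assoc)
qed

lemma has_directionI:
  assumes "aff_dim \<epsilon> = 1" "u \<noteq> 0" and x: "x \<in> affine hull \<epsilon>" and xu: "x + u \<in> affine hull \<epsilon>"
  shows "has_direction \<epsilon> u"
proof -
  have "(+) x ` span {u} \<subseteq> affine hull \<epsilon>"
  proof clarify
    fix y assume "y \<in> span {u}"
    then obtain t where "y = t *\<^sub>R u" by (auto simp: span_singleton)
    moreover have "(1 - t) *\<^sub>R x + t *\<^sub>R (x + u) \<in> affine hull \<epsilon>"
      using x xu by (intro mem_affine affine_affine_hull) auto
    ultimately show "x + y \<in> affine hull \<epsilon>" by (simp add: algebra_simps)
  qed
  moreover have "affine ((+) x ` span {u})"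
    using subspace_imp_affine[OF subspace_span] affine_translation by blast
  moreover have "aff_dim ((+) x ` span {u}) = aff_dim (affine hull \<epsilon>)"
    using assms(1,2) by (simp add: aff_dim_translation_eq aff_dim_subspace dim_singleton)
  moreover have "(+) x ` span {u} \<noteq> {}" using span_zero by blast
  ultimately have "(+) x ` span {u} = affine hull \<epsilon>"
    by (intro affine_dim_equal affine_affine_hull)
  then have "affine_parallel (span {u}) (affine hull \<epsilon>)" unfolding affine_parallel_def by blast
  then show ?thesis unfolding has_direction_def by (rule affine_parallel_commute)
qed

lemma ex_nowhere_zero:
  assumes U: "subspace U" and "finite A" "A \<subseteq> ground U"
  shows "\<exists>g\<in>U. \<forall>f\<in>A. g $ f \<noteq> 0"
  using assms(2,3)
proof (induct A)
  case empty
  show ?case using subspace_0[OF U] by auto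
next
  case (insert a A)
  then obtain g h where g: "g \<in> U" "\<forall>f\<in>A. g $ f \<noteq> 0" and h: "h \<in> U" "h $ a \<noteq> 0"
    by (auto simp: ground_def)
  \<comment> \<open>Where \<open>h $ f = 0\<close> the quotient is 0 by convention, which excludes
    one harmless value of \<open>t\<close>; at such \<open>f\<close> the sum is
    \<open>g $ f\<close>, already nonzero.\<close>
  obtain t where t: "t \<notin> (\<lambda>f. - g $ f / h $ f) ` insert a A"
    using ex_new_if_finite[OF infinite_UNIV_char_0] insert(1) by (metis finite_imageI finite_insert)
  have "(g + t *\<^sub>R h) $ f \<noteq> 0" if f: "f \<in> insert a A" for f
  proof
    assume 0: "(g + t *\<^sub>R h) $ f = 0"
    show False
    proof (cases "h $ f = 0")
      case True
      then show False using 0 f g(2) h(2) by auto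
    next
      case False
      then have "t = - g $ f / h $ f" using 0 by (simp add: field_simps)
      then show False using t f by blast
    qed
  qed
  then show ?case using g(1) h(1) U by (intro bexI[of _ "g + t *\<^sub>R h"]) (auto simp: subspace_add subspace_scale)
qed

section \<open>Projected unit vectors and one-dimensional faces\<close>

context regular_space
begin

lemma ex_dual: "\<exists>p. p \<in> W \<and> (\<forall>w\<in>W. p \<bullet> w = w $ e)"
proof -
  obtain y z where yz: "y \<in> span W" "\<And>w. w \<in> span W \<Longrightarrow> orthogonal z w" "axis e 1 = y + z"
    using orthogonal_subspace_decomp_exists[of W "axis e 1"] by metis
  have W: "span W = W" using subspace_W by (simp add: span_eq_iff)
  have "y \<bullet> w = w $ e" if "w \<in> W" for w
  proof -
    have "z \<bullet> w = 0" using yz(2) that W by (auto simp: orthogonal_def)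
    then have "y \<bullet> w = axis e 1 \<bullet> w" by (simp add: yz(3) inner_add_left)
    then show ?thesis by (simp add: inner_axis inner_commute)
  qed
  then show ?thesis using yz(1) W by blast
qed

definition dual :: "'e \<Rightarrow> real ^ 'e" where
  "dual e = (SOME p. p \<in> W \<and> (\<forall>w\<in>W. p \<bullet> w = w $ e))"

lemma dual_in: "dual e \<in> W"
  and dual_inner: "w \<in> W \<Longrightarrow> dual e \<bullet> w = w $ e"
  using someI_ex[OF ex_dual[of e]] by (auto simp: dual_def)

lemma W_eqI:
  assumes "x \<in> W" "y \<in> W" "\<And>w. w \<in> W \<Longrightarrow> x \<bullet> w = y \<bullet> w"
  shows "x = y"
proof -
  have "(x - y) \<bullet> (x - y) = 0" using assms(3)[OF W_diff[OF assms(1,2)]] by (simp add: inner_diff_left)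
  then show ?thesis by simp
qed

lemma dual_nonzero: "e \<in> ground W \<Longrightarrow> dual e \<noteq> 0"
proof
  assume "e \<in> ground W" "dual e = 0"
  then show False using dual_inner[of _ e] by (auto simp: ground_def)
qed

lemma span_dual_eq_iff:
  assumes e: "e \<in> ground W" and f: "f \<in> ground W"
  shows "span {dual e} = span {dual f} \<longleftrightarrow> parallel_in W e f"
proof
  assume "span {dual e} = span {dual f}"
  then have "dual e \<in> span {dual f}" "dual f \<in> span {dual e}" by (auto intro: span_base)
  then obtain s t where "dual e = s *\<^sub>R dual f" "dual f = t *\<^sub>R dual e"
    unfolding span_singleton by blast
  then have "\<forall>w. dual e \<bullet> w = s * (dual f \<bullet> w)" "\<forall>w. dual f \<bullet> w = t * (dual e \<bullet> w)"
    by (metis inner_scaleR_left)+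
  then have "w $ e = s * w $ f" "w $ f = t * w $ e" if "w \<in> W" for w
    using dual_inner[OF that] by metis+
  then show "parallel_in W e f" by (auto simp: parallel_in_def)
next
  assume "parallel_in W e f"
  then obtain s where s: "s \<in> {-1, 1::real}" "\<And>x. x \<in> W \<Longrightarrow> x $ e = s * x $ f"
    using parallel_in_signed[OF f] by blast
  then have "dual e = s *\<^sub>R dual f" by (intro W_eqI W_scale dual_in) (simp add: dual_inner)
  then have "dual e = dual f \<or> dual e = - dual f" using s(1) by auto
  then show "span {dual e} = span {dual f}"
  proof
    assume *: "dual e = - dual f"
    show ?thesis
    proof (rule subset_antisym; rule span_minimal; simp)
      show "dual e \<in> span {dual f}" unfolding * by (intro span_neg span_base) simp
      have "dual f = - dual e" using * by simp
      then show "dual f \<in> span {dual e}" by (metis insertI1 span_base span_neg)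
    qed
  qed simp
qed

definition project :: "real ^ 'e \<Rightarrow> real ^ 'e" where
  "project y = (\<Sum>e\<in>UNIV. (y $ e) *\<^sub>R dual e)"

lemma project_in: "project y \<in> W"
  unfolding project_def by (intro W_sum W_scale dual_in)

lemma project_inner: "w \<in> W \<Longrightarrow> project y \<bullet> w = y \<bullet> w"
proof -
  assume "w \<in> W"
  then have "project y \<bullet> w = (\<Sum>e\<in>UNIV. y $ e * w $ e)"
    by (simp add: project_def inner_sum_left dual_inner)
  then show ?thesis by (simp add: inner_vec_def)
qed

lemma project_cell: "(\<And>e. \<bar>y $ e\<bar> \<le> 1/2) \<Longrightarrow> project y \<in> cell"
  unfolding cell_iff_l1 using inner_le_l1[of y] by (auto simp: project_in project_inner)

text \<open>A point of the half cube that maximises the inner product with \<open>v\<close>. Its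
  value 0 at the zeros of \<open>v\<close> leaves room to move by 1/2 in either direction
  there.\<close>

definition sign_vector :: "real ^ 'e \<Rightarrow> real ^ 'e" where
  "sign_vector v = (\<chi> e. sgn (v $ e) / 2)"

lemma sign_vector_bound: "\<bar>sign_vector v $ e\<bar> \<le> 1/2"
  by (simp add: sign_vector_def sgn_real_def)

lemma sign_vector_inner_conform:
  assumes "\<And>e. w $ e \<noteq> 0 \<Longrightarrow> 0 < v $ e * w $ e"
  shows "sign_vector v \<bullet> w = l1 w / 2"
  unfolding sign_vector_def l1_def inner_vec_def sum_divide_distrib
proof (rule sum.cong)
  fix e
  show "(\<chi> e. sgn (v $ e) / 2) $ e \<bullet> w $ e = \<bar>w $ e\<bar> / 2"
    using assms[of e] by (cases "w $ e = 0") (auto simp: sgn_real_def zero_less_mult_iff)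
qed simp

lemma sign_vector_inner_self: "sign_vector v \<bullet> v = l1 v / 2"
  by (rule sign_vector_inner_conform) (metis not_real_square_gt_zero)

lemma project_sign_vector:
  assumes "v \<in> W"
  shows "project (sign_vector v) \<in> support_face v"
  using assms by (simp add: support_face_def project_cell[OF sign_vector_bound] project_inner sign_vector_inner_self)

text \<open>Small multiples of \<open>w\<close> change no sign of \<open>v\<close>, so
  \<open>l1 (v + s *\<^sub>R w)\<close> is linear in \<open>s\<close> near 0. The inequality at
  \<open>s\<close> and at \<open>- s\<close>, together with tightness at \<open>v\<close>, becomes
  an equality. The support face can therefore extend only in directions orthogonal to all such
  \<open>w\<close>.\<close>

lemma support_face_inner:
  assumes v: "v \<in> W" and w: "w \<in> W" and supp: "\<And>e. v $ e = 0 \<Longrightarrow> w $ e = 0"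
    and x: "x \<in> support_face v"
  shows "x \<bullet> w = sign_vector v \<bullet> w"
proof -
  have "\<exists>\<delta>>0. \<forall>s. \<bar>s\<bar> \<le> \<delta> \<longrightarrow> (\<forall>e\<in>UNIV. \<bar>v $ e + s * w $ e\<bar> = sgn (v $ e) * (v $ e + s * w $ e))"
  proof (rule finite_uniform_delta)
    fix e
    show "\<exists>\<delta>>0. \<forall>s. \<bar>s\<bar> \<le> \<delta> \<longrightarrow> \<bar>v $ e + s * w $ e\<bar> = sgn (v $ e) * (v $ e + s * w $ e)"
    proof (cases "v $ e = 0")
      case True
      then show ?thesis using supp[of e] by (intro exI[of _ 1]) auto
    next
      case False
      have "\<bar>v $ e + s * w $ e\<bar> = sgn (v $ e) * (v $ e + s * w $ e)"
        if "\<bar>s\<bar> \<le> \<bar>v $ e\<bar> / (\<bar>w $ e\<bar> + 1)" for s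
      proof -
        have "\<bar>s * w $ e\<bar> \<le> \<bar>s\<bar> * (\<bar>w $ e\<bar> + 1)" unfolding abs_mult by (intro mult_left_mono) auto
        also have "\<dots> \<le> \<bar>v $ e\<bar>" using that by (simp add: pos_le_divide_eq)
        finally show ?thesis using False by (auto simp: sgn_real_def abs_if split: if_splits)
      qed
      then show ?thesis using False by (intro exI[of _ "\<bar>v $ e\<bar> / (\<bar>w $ e\<bar> + 1)"]) auto
    qed
  qed simp
  then obtain \<delta> where "\<delta> > 0"
    and \<delta>: "\<And>s e. \<bar>s\<bar> \<le> \<delta> \<Longrightarrow> \<bar>v $ e + s * w $ e\<bar> = sgn (v $ e) * (v $ e + s * w $ e)" by auto
  have "s * (x \<bullet> w - sign_vector v \<bullet> w) \<le> 0" if "\<bar>s\<bar> \<le> \<delta>" for s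
  proof -
    have "l1 (v + s *\<^sub>R w) = (\<Sum>e\<in>UNIV. sgn (v $ e) * (v $ e + s * w $ e))"
      by (simp add: l1_def \<delta>[OF that])
    also have "\<dots> = 2 * (sign_vector v \<bullet> (v + s *\<^sub>R w))"
      by (simp add: sign_vector_def inner_vec_def sum_distrib_left)
    also have "\<dots> = l1 v + 2 * s * (sign_vector v \<bullet> w)"
      by (simp add: inner_add_right sign_vector_inner_self)
    finally have "l1 (v + s *\<^sub>R w) = l1 v + 2 * s * (sign_vector v \<bullet> w)" .
    moreover have "x \<bullet> (v + s *\<^sub>R w) \<le> l1 (v + s *\<^sub>R w) / 2"
      using x v w by (auto simp: support_face_def cell_iff_l1 W_add W_scale)
    moreover have "x \<bullet> v = l1 v / 2" using x by (simp add: support_face_def)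
    ultimately show ?thesis by (simp add: inner_add_right algebra_simps)
  qed
  from this[of \<delta>] this[of "- \<delta>"] \<open>\<delta> > 0\<close> show ?thesis
    by (simp add: mult_le_0_iff zero_le_mult_iff)
qed

text \<open>At a relative interior point x of the edge let v be the sum of the tight circuits.
  Tightness makes \<open>l1\<close> additive on this sum, so every tight circuit is supported where
  v is nonzero. If v were nonzero on all of \<open>ground W\<close>, its support face would be a
  point. Hence all tight circuits avoid some \<open>e\<close> in \<open>ground W\<close>, and the
  cell extends from x both ways along \<open>dual e\<close>.\<close>

lemma cell_edge_direction:
  assumes "\<epsilon> \<in> cell_edges lattice"
  shows "\<exists>e\<in>ground W. has_direction \<epsilon> (dual e)"
proof -
  have face: "\<epsilon> face_of cell" and dim: "aff_dim \<epsilon> = 1" using assms by (auto simp: cell_edges_def)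
  have "\<epsilon> \<noteq> {}" using dim by auto
  then obtain x where x: "x \<in> rel_interior \<epsilon>" using rel_interior_eq_empty face_of_imp_convex face by blast
  have x\<epsilon>: "x \<in> \<epsilon>" using x rel_interior_subset by blast
  have xcell: "x \<in> cell" using x\<epsilon> face face_of_imp_subset by blast
  define T where "T = {c\<in>C. x \<bullet> c = (c \<bullet> c) / 2}"
  have T: "finite T" "T \<subseteq> C" by (auto simp: T_def)
  define v where "v = (\<Sum>c\<in>T. c)"
  have vW: "v \<in> W" unfolding v_def using T by (intro W_sum circuit_in) auto
  have "x \<bullet> v = (\<Sum>c\<in>T. l1 c) / 2"
    unfolding v_def inner_sum_right sum_divide_distrib
    by (intro sum.cong) (auto simp: T_def circuit_inner)
  moreover have "x \<bullet> v \<le> l1 v / 2" using xcell vW by (simp add: cell_iff_l1)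
  moreover have ve: "\<bar>v $ e\<bar> \<le> (\<Sum>c\<in>T. \<bar>c $ e\<bar>)" for e unfolding v_def sum_component by (rule sum_abs)
  have sw: "(\<Sum>c\<in>T. l1 c) = (\<Sum>e\<in>UNIV. \<Sum>c\<in>T. \<bar>c $ e\<bar>)" unfolding l1_def by (rule sum.swap)
  have "l1 v \<le> (\<Sum>c\<in>T. l1 c)" unfolding sw unfolding l1_def by (intro sum_mono ve)
  ultimately have l1v: "l1 v = (\<Sum>c\<in>T. l1 c)" and xv: "x \<in> support_face v"
    using xcell by (auto simp: support_face_def)
  have "(\<Sum>e\<in>UNIV. (\<Sum>c\<in>T. \<bar>c $ e\<bar>) - \<bar>v $ e\<bar>) = 0"
    using l1v unfolding sw by (simp add: l1_def sum_subtractf)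
  then have "\<forall>e\<in>UNIV. (\<Sum>c\<in>T. \<bar>c $ e\<bar>) - \<bar>v $ e\<bar> = 0"
    by (subst (asm) sum_nonneg_eq_0_iff) (use ve in auto)
  then have "(\<Sum>c\<in>T. \<bar>c $ e\<bar>) = \<bar>v $ e\<bar>" for e by simp
  then have supp: "c $ e = 0" if "c \<in> T" "v $ e = 0" for c e
  proof -
    have "(\<Sum>c\<in>T. \<bar>c $ e\<bar>) = 0" using \<open>(\<Sum>c\<in>T. \<bar>c $ e\<bar>) = \<bar>v $ e\<bar>\<close> that(2) by simp
    then have "\<forall>c\<in>T. \<bar>c $ e\<bar> = 0" using T(1) by (subst (asm) sum_nonneg_eq_0_iff) auto
    then show ?thesis using that(1) by simp
  qed
  have "\<epsilon> \<subseteq> support_face v"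
    using support_face_face_of[OF vW] face face_of_imp_subset x xv
    by (intro subset_of_face_of[OF support_face_face_of[OF vW]]) (auto simp: disjnt_iff)
  have "\<epsilon> \<noteq> {x}" using dim by auto
  then obtain y where y: "y \<in> \<epsilon>" "y \<noteq> x" using x\<epsilon> by blast
  have yW: "y - x \<in> W" using y x\<epsilon> face face_of_imp_subset cell_subset by (intro W_diff) blast+
  have "\<exists>e\<in>ground W. v $ e = 0"
  proof (rule ccontr)
    assume "\<not> (\<exists>e\<in>ground W. v $ e = 0)"
    then have "w $ e = 0" if "w \<in> W" "v $ e = 0" for w e using that by (auto simp: ground_def)
    then have "y \<bullet> (y - x) = x \<bullet> (y - x)"
      using support_face_inner[OF vW yW] xv y(1) \<open>\<epsilon> \<subseteq> support_face v\<close> yW by (metis subsetD)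
    then have "(y - x) \<bullet> (y - x) = 0" by (simp add: inner_diff_left)
    then show False using y(2) by simp
  qed
  then obtain e where e: "e \<in> ground W" "v $ e = 0" by blast
  have "\<exists>\<delta>>0. \<forall>s. \<bar>s\<bar> \<le> \<delta> \<longrightarrow> x + s *\<^sub>R dual e \<in> cell"
    using xcell dual_in by (rule cell_perturb) (use supp e(2) in \<open>auto simp: T_def dual_inner circuit_in\<close>)
  then obtain \<delta> where \<delta>: "\<delta> > 0" "x + \<delta> *\<^sub>R dual e \<in> cell" "x + (- \<delta>) *\<^sub>R dual e \<in> cell"
    by (metis abs_minus_cancel abs_of_pos order_refl)
  let ?a = "x + (- \<delta>) *\<^sub>R dual e" and ?b = "x + \<delta> *\<^sub>R dual e"
  have "x = (1 - 1/2) *\<^sub>R ?a + (1/2) *\<^sub>R ?b"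
    by (simp add: vec_eq_iff field_simps)
  moreover have "?a \<noteq> ?b"
  proof
    assume "?a = ?b"
    then have "?a $ i = ?b $ i" for i by (rule arg_cong)
    then have "\<delta> * dual e $ i = 0" for i by (simp add: eq_neg_iff_add_eq_0)
    then show False using \<delta>(1) dual_nonzero[OF e(1)] by (simp add: vec_eq_iff)
  qed
  ultimately have "x \<in> open_segment ?a ?b" unfolding in_segment by (auto intro!: exI[of _ "1/2"])
  then have "?b \<in> \<epsilon>" using face \<delta>(2,3) x\<epsilon> by (auto simp: face_of_def)
  then have "(1 - 1/\<delta>) *\<^sub>R x + (1/\<delta>) *\<^sub>R ?b \<in> affine hull \<epsilon>"
    using x\<epsilon> by (intro mem_affine[OF affine_affine_hull] hull_inc) auto
  moreover have "(1 - 1/\<delta>) *\<^sub>R x + (1/\<delta>) *\<^sub>R ?b = x + dual e"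
    using \<delta>(1) by (simp add: scaleR_add_right scaleR_left_diff_distrib)
  ultimately have "has_direction \<epsilon> (dual e)"
    using dim dual_nonzero[OF e(1)] x\<epsilon> by (intro has_directionI[of _ _ x]) (auto intro: hull_inc)
  then show ?thesis using e(1) by blast
qed

text \<open>The edge is the support face of a flow that vanishes at \<open>e\<close> and is nonzero
  wherever some flow avoiding \<open>e\<close> is: all directions but \<open>dual e\<close> are then
  fixed. Admitting \<open>c = 0\<close>, whose \<open>voronoi_face\<close> is the whole cell, covers
  bare existence.\<close>

lemma cell_edge_exists:
  assumes e: "e \<in> ground W" and c: "c \<in> insert 0 C" "c $ e = 0"
  shows "\<exists>\<epsilon>\<in>cell_edges lattice. has_direction \<epsilon> (dual e) \<and> \<epsilon> \<subseteq> circuit_face c"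
proof -
  let ?U = "W \<inter> {x. x $ e = 0}"
  interpret D: regular_space ?U "{c\<in>C. c $ e = 0}" by (rule regular_space_delete)
  obtain g where g: "g \<in> ?U" "\<forall>f\<in>ground ?U. g $ f \<noteq> 0"
    using ex_nowhere_zero[OF D.subspace_W, of "ground ?U"] by auto
  have cW: "c \<in> W" using c circuit_in by auto
  \<comment> \<open>Exceeds every \<open>\<bar>g $ f\<bar>\<close>, so that \<open>v\<close> takes
    the sign of \<open>c\<close> on the support of \<open>c\<close> and coincides with
    \<open>g\<close> elsewhere.\<close>
  define M where "M = (\<Sum>f\<in>UNIV. \<bar>g $ f\<bar>) + 1"
  have M: "\<bar>g $ f\<bar> < M" for f
    using member_le_sum[of f UNIV "\<lambda>f. \<bar>g $ f\<bar>"] by (simp add: M_def)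
  define v where "v = g + M *\<^sub>R c"
  have vU: "v \<in> ?U" unfolding v_def using g(1) c(2) cW by (simp add: W_add W_scale)
  have entry: "c $ f = 1 \<or> c $ f = -1 \<or> c $ f = 0" for f using c(1) circuit_entry[of c f] by auto
  have conf: "0 < v $ f * c $ f" if "c $ f \<noteq> 0" for f
    using entry[of f] that M[of f] by (auto simp: v_def)
  have supp: "w $ f = 0" if "w \<in> ?U" "v $ f = 0" for w f
  proof -
    have "c $ f = 0" using conf[of f] that(2) by auto
    then have "g $ f = 0" using that(2) by (simp add: v_def)
    then show ?thesis using g(2) that(1) by (auto simp: ground_def)
  qed
  have vW: "v \<in> W" and ve: "v $ e = 0" using vU by auto
  have face: "support_face v face_of cell" using vW by (rule support_face_face_of)
  define x where "x = project (sign_vector v)"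
  have x: "x \<in> support_face v" unfolding x_def using vW by (rule project_sign_vector)
  \<comment> \<open>Since \<open>v $ e = 0\<close>, the coordinate at \<open>e\<close> can move from
    0 to 1/2 inside the cube without affecting the inner product with \<open>v\<close>. This gives a
    second point of the face.\<close>
  have "project (sign_vector v + axis e (1/2)) = x + (1/2) *\<^sub>R dual e"
    by (intro W_eqI W_add W_scale project_in dual_in)
      (auto simp: x_def project_in project_inner inner_add_left dual_inner inner_axis' W_add W_scale dual_in)
  moreover have "project (sign_vector v + axis e (1/2)) \<in> cell"
  proof (rule project_cell)
    fix f show "\<bar>(sign_vector v + axis e (1/2)) $ f\<bar> \<le> 1/2"
      using sign_vector_bound[of v f] ve by (cases "f = e") (auto simp: axis_def sign_vector_def)
  qed
  ultimately have x': "x + (1/2) *\<^sub>R dual e \<in> support_face v"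
    using x vW ve by (auto simp: support_face_def inner_add_left dual_inner)
  obtain a where a: "a \<in> W" "a $ e = 1" using ground_unit[OF e] by blast
  have "support_face v \<subseteq> (+) x ` span {dual e}"
  proof
    fix y assume y: "y \<in> support_face v"
    have yx: "y - x \<in> W" using x y cell_subset by (intro W_diff) (auto simp: support_face_def)
    have perp: "(y - x) \<bullet> w = 0" if "w \<in> ?U" for w
      using support_face_inner[OF vW _ supp[OF that] y] support_face_inner[OF vW _ supp[OF that] x] that
      by (simp add: inner_diff_left)
    \<comment> \<open>As \<open>a $ e = 1\<close>, the vector \<open>w - (w $ e) *\<^sub>R a\<close>
      vanishes at \<open>e\<close> and is orthogonal to \<open>y - x\<close>; only the multiple of
      \<open>a\<close> contributes.\<close>
    have "y - x = ((y - x) \<bullet> a) *\<^sub>R dual e"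
    proof (intro W_eqI yx W_scale dual_in)
      fix w assume w: "w \<in> W"
      then have "(y - x) \<bullet> (w - (w $ e) *\<^sub>R a) = 0" using a by (intro perp) (simp add: W_diff W_scale)
      then show "(y - x) \<bullet> w = (((y - x) \<bullet> a) *\<^sub>R dual e) \<bullet> w"
        using w by (simp add: inner_diff_right dual_inner)
    qed
    then have "y - x \<in> span {dual e}" by (metis insertI1 span_base span_scale)
    then show "y \<in> (+) x ` span {dual e}" by (intro image_eqI[of _ _ "y - x"]) auto
  qed
  then have "aff_dim (support_face v) \<le> aff_dim ((+) x ` span {dual e})" by (rule aff_dim_subset)
  also have "\<dots> = 1" using dual_nonzero[OF e] by (simp add: aff_dim_translation_eq aff_dim_subspace dim_singleton)
  finally have le: "aff_dim (support_face v) \<le> 1" .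
  have "x \<noteq> x + (1/2) *\<^sub>R dual e" using dual_nonzero[OF e] by simp
  then have "aff_dim {x, x + (1/2) *\<^sub>R dual e} = 1" by (simp add: aff_dim_2)
  then have "1 \<le> aff_dim (support_face v)" using x x' aff_dim_subset[of "{x, x + (1/2) *\<^sub>R dual e}" "support_face v"] by auto
  with le have dim: "aff_dim (support_face v) = 1" by simp
  then have edge: "support_face v \<in> cell_edges lattice" using face by (simp add: cell_edges_def)
  have "(1 - 2) *\<^sub>R x + 2 *\<^sub>R (x + (1/2) *\<^sub>R dual e) \<in> affine hull (support_face v)"
    using x x' by (intro mem_affine[OF affine_affine_hull] hull_inc) auto
  then have "x + dual e \<in> affine hull (support_face v)" by (simp add: scaleR_2 algebra_simps)
  then have dir: "has_direction (support_face v) (dual e)"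
    using dim dual_nonzero[OF e] x by (intro has_directionI[of _ _ x]) (auto intro: hull_inc)
  have "support_face v \<subseteq> circuit_face c"
  proof
    fix y assume y: "y \<in> support_face v"
    have "c \<in> ?U" using cW c(2) by simp
    then have "y \<bullet> c = sign_vector v \<bullet> c" using supp by (intro support_face_inner[OF vW cW _ y]) blast
    also have "\<dots> = l1 c / 2" by (rule sign_vector_inner_conform) (rule conf)
    also have "l1 c = c \<bullet> c" using entry by (intro l1_eq_inner_self) auto
    finally show "y \<in> circuit_face c" using y by (simp add: voronoi_face_def support_face_def)
  qed
  then show ?thesis using edge dir by blast
qed

definition edge_class :: "'e \<Rightarrow> (real ^ 'e) set set" where
  "edge_class e = {\<epsilon>\<in>cell_edges lattice. has_direction \<epsilon> (dual e)}"

lemma edge_class_nonempty: "e \<in> ground W \<Longrightarrow> edge_class e \<noteq> {}"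
  using cell_edge_exists[of e 0] by (auto simp: edge_class_def)

lemma edge_class_eq_iff:
  assumes e: "e \<in> ground W" and f: "f \<in> ground W"
  shows "edge_class e = edge_class f \<longleftrightarrow> parallel_in W e f"
proof
  assume eq: "edge_class e = edge_class f"
  obtain \<epsilon> where "\<epsilon> \<in> edge_class e" using edge_class_nonempty[OF e] by blast
  then have "has_direction \<epsilon> (dual e)" "has_direction \<epsilon> (dual f)" using eq by (auto simp: edge_class_def)
  then have "span {dual e} = span {dual f}" using has_direction_unique affine_parallel_reflex by blast
  then show "parallel_in W e f" by (simp add: span_dual_eq_iff[OF e f])
next
  assume "parallel_in W e f"
  then show "edge_class e = edge_class f"
    by (simp add: edge_class_def has_direction_def flip: span_dual_eq_iff[OF e f])
qed

lemma edge_classes_eq: "edge_classes lattice = edge_class ` ground W"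
proof -
  let ?R = "{(\<epsilon>, \<delta>) \<in> cell_edges lattice \<times> cell_edges lattice. affine_parallel (affine hull \<epsilon>) (affine hull \<delta>)}"
  have cls: "?R `` {\<epsilon>} = edge_class e" if "\<epsilon> \<in> edge_class e" "e \<in> ground W" for \<epsilon> e
  proof -
    have \<epsilon>: "\<epsilon> \<in> cell_edges lattice" "has_direction \<epsilon> (dual e)" using that(1) by (auto simp: edge_class_def)
    have "affine_parallel (affine hull \<epsilon>) (affine hull \<delta>) \<longleftrightarrow> has_direction \<delta> (dual e)" for \<delta>
      using \<epsilon>(2) unfolding has_direction_def by (meson affine_parallel_assoc affine_parallel_commute)
    then show ?thesis using \<epsilon>(1) by (auto simp: edge_class_def)
  qed
  show ?thesis
  proof
    show "edge_classes lattice \<subseteq> edge_class ` ground W"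
    proof
      fix k assume "k \<in> edge_classes lattice"
      then obtain \<epsilon> where \<epsilon>: "\<epsilon> \<in> cell_edges lattice" "k = ?R `` {\<epsilon>}"
        unfolding edge_classes_def by (rule quotientE)
      then obtain e where "e \<in> ground W" "\<epsilon> \<in> edge_class e"
        using cell_edge_direction by (auto simp: edge_class_def)
      then show "k \<in> edge_class ` ground W" using cls \<epsilon>(2) by blast
    qed
    show "edge_class ` ground W \<subseteq> edge_classes lattice"
    proof clarify
      fix e assume e: "e \<in> ground W"
      then obtain \<epsilon> where \<epsilon>: "\<epsilon> \<in> edge_class e" using edge_class_nonempty by blast
      then have "\<epsilon> \<in> cell_edges lattice" by (simp add: edge_class_def)
      then have "?R `` {\<epsilon>} \<in> edge_classes lattice" unfolding edge_classes_def by (rule quotientI)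
      then show "edge_class e \<in> edge_classes lattice" using cls[OF \<epsilon> e] by simp
    qed
  qed
qed

text \<open>A segment in the face of \<open>c\<close> has a direction orthogonal to
  \<open>c\<close>, whereas \<open>dual e \<bullet> c = c $ e\<close>. The converse is the existence
  of an edge inside the face.\<close>

lemma edge_class_avoids_iff:
  assumes c: "c \<in> C" and e: "e \<in> ground W"
  shows "(\<forall>\<epsilon>\<in>edge_class e. \<not> \<epsilon> \<subseteq> circuit_face c) \<longleftrightarrow> c $ e \<noteq> 0"
proof
  show "\<forall>\<epsilon>\<in>edge_class e. \<not> \<epsilon> \<subseteq> circuit_face c \<Longrightarrow> c $ e \<noteq> 0"
    using cell_edge_exists[OF e, of c] c by (auto simp: edge_class_def)
  assume ce: "c $ e \<noteq> 0"
  show "\<forall>\<epsilon>\<in>edge_class e. \<not> \<epsilon> \<subseteq> circuit_face c"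
  proof (intro ballI notI)
    fix \<epsilon> assume \<epsilon>: "\<epsilon> \<in> edge_class e" "\<epsilon> \<subseteq> circuit_face c"
    then have dir: "has_direction \<epsilon> (dual e)" and "\<epsilon> \<noteq> {}" by (auto simp: edge_class_def cell_edges_def)
    then obtain x where x: "x \<in> \<epsilon>" by blast
    have "affine hull \<epsilon> \<subseteq> {y. c \<bullet> y = (c \<bullet> c) / 2}"
      using \<epsilon>(2) by (intro hull_minimal affine_hyperplane) (auto simp: voronoi_face_def inner_commute)
    moreover have "x \<in> affine hull \<epsilon>" using x by (rule hull_inc)
    ultimately have "c \<bullet> x = (c \<bullet> c) / 2" "c \<bullet> (x + dual e) = (c \<bullet> c) / 2"
      using has_direction_translate[OF dir] by blast+
    then have "dual e \<bullet> c = 0" by (simp add: inner_add_right inner_commute)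
    then show False using ce by (simp add: dual_inner circuit_in[OF c])
  qed
qed

lemma finite_facets: "finite {F. F facet_of cell}"
  and finite_cell_edges: "finite (cell_edges lattice)"
  and finite_edge_classes: "finite (edge_classes lattice)"
proof -
  have fin: "finite {F. F face_of cell}" using finite_polyhedron_faces[OF polyhedron_cell] .
  show "finite {F. F facet_of cell}" by (rule finite_subset[OF _ fin]) (auto simp: facet_of_def)
  show "finite (cell_edges lattice)" by (rule finite_subset[OF _ fin]) (auto simp: cell_edges_def)
  show "finite (edge_classes lattice)" by (simp add: edge_classes_eq)
qed

end

section \<open>Cancellation-free circuit bases\<close>

text \<open>The global sign \<open>s\<close> absorbs the choice between \<open>d\<close> and
  \<open>- d\<close>, matching the choice between two opposite faces in the condition on the
  basis.\<close>

definition agree :: "real ^ 'e::finite \<Rightarrow> real ^ 'e \<Rightarrow> bool" where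
  "agree c d \<longleftrightarrow> (\<exists>s\<in>{-1, 1}. \<forall>e. 0 \<le> s * (c $ e * d $ e))"

lemma agree_abs_inner:
  assumes "agree c d"
  shows "\<bar>c \<bullet> d\<bar> = (\<Sum>e\<in>UNIV. \<bar>c $ e * d $ e\<bar>)"
proof -
  obtain s where s: "s \<in> {-1, 1::real}" "\<And>e. 0 \<le> s * (c $ e * d $ e)" using assms unfolding agree_def by blast
  have "\<bar>c $ e * d $ e\<bar> = s * (c $ e * d $ e)" for e using s(1) s(2)[of e] by auto
  then have *: "(\<Sum>e\<in>UNIV. \<bar>c $ e * d $ e\<bar>) = s * (c \<bullet> d)" by (simp add: inner_vec_def sum_distrib_left)
  moreover have "0 \<le> (\<Sum>e\<in>UNIV. \<bar>c $ e * d $ e\<bar>)" by (rule sum_nonneg) simp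
  ultimately show ?thesis using s(1) by auto
qed

text \<open>All of \<open>L\<close> vanishes at \<open>e\<close>, so the coordinate at
  \<open>e\<close> alone determines the coefficient of \<open>c\<close>; the remaining coefficients
  come from the old basis.\<close>

lemma lattice_basis_insert:
  fixes L L' :: "(real ^ 'e::finite) set"
  assumes B: "lattice_basis L B" and sub: "L \<subseteq> L'" and c: "c \<in> L'" "c $ e \<noteq> 0"
    and van: "\<And>v. v \<in> L \<Longrightarrow> v $ e = 0"
    and red: "\<And>v. v \<in> L' \<Longrightarrow> \<exists>t::int. v - of_int t *\<^sub>R c \<in> L"
  shows "lattice_basis L' (insert c B)"
proof -
  have fin: "finite B" and BL: "B \<subseteq> L"
    and uniq: "\<And>v. v \<in> L \<Longrightarrow> \<exists>!a. a \<in> B \<rightarrow>\<^sub>E (UNIV :: int set) \<and> v = (\<Sum>b\<in>B. of_int (a b) *\<^sub>R b)"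
    using B unfolding lattice_basis_def by simp_all
  have cB: "c \<notin> B" using BL van c(2) by blast
  have "\<exists>!a. a \<in> insert c B \<rightarrow>\<^sub>E (UNIV :: int set) \<and> v = (\<Sum>b\<in>insert c B. of_int (a b) *\<^sub>R b)"
    if v: "v \<in> L'" for v
  proof -
    obtain t where t: "v - of_int t *\<^sub>R c \<in> L" using red[OF v] by blast
    obtain a where a: "a \<in> B \<rightarrow>\<^sub>E (UNIV :: int set)" "v - of_int t *\<^sub>R c = (\<Sum>b\<in>B. of_int (a b) *\<^sub>R b)"
      and a_uniq: "\<And>a'. a' \<in> B \<rightarrow>\<^sub>E (UNIV :: int set) \<Longrightarrow>
        v - of_int t *\<^sub>R c = (\<Sum>b\<in>B. of_int (a' b) *\<^sub>R b) \<Longrightarrow> a' = a"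
      using uniq[OF t] by (elim ex1E conjE) blast
    show ?thesis
    proof (rule ex1I[of _ "a(c := t)"], intro conjI)
      show "a(c := t) \<in> insert c B \<rightarrow>\<^sub>E UNIV" using a(1) by (auto simp: PiE_def extensional_def)
      have "(\<Sum>b\<in>B. of_int ((a(c := t)) b) *\<^sub>R b) = (\<Sum>b\<in>B. of_int (a b) *\<^sub>R b)"
        using cB by (intro sum.cong) auto
      then show "v = (\<Sum>b\<in>insert c B. of_int ((a(c := t)) b) *\<^sub>R b)"
        using fin cB a(2) by (simp add: algebra_simps)
    next
      fix a' assume a': "a' \<in> insert c B \<rightarrow>\<^sub>E (UNIV :: int set) \<and> v = (\<Sum>b\<in>insert c B. of_int (a' b) *\<^sub>R b)"
      then have veq: "v = of_int (a' c) *\<^sub>R c + (\<Sum>b\<in>B. of_int (a' b) *\<^sub>R b)" using fin cB by simp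
      have "(\<Sum>b\<in>B. of_int (a' b) *\<^sub>R b) $ e = 0"
        using BL van by (auto simp: sum_component intro!: sum.neutral)
      then have "v $ e = of_int (a' c) * c $ e" by (subst veq) simp
      moreover have "v $ e = of_int t * c $ e" using van[OF t] by simp
      ultimately have t': "a' c = t" using c(2) by simp
      have "restrict a' B = a"
      proof (rule a_uniq)
        have "(\<Sum>b\<in>B. of_int (restrict a' B b) *\<^sub>R b) = (\<Sum>b\<in>B. of_int (a' b) *\<^sub>R b)"
          by (intro sum.cong) auto
        then show "v - of_int t *\<^sub>R c = (\<Sum>b\<in>B. of_int (restrict a' B b) *\<^sub>R b)"
          using veq t' by simp
      qed simp
      then have *: "restrict a' B x = a x" for x by simp
      show "a' = a(c := t)"
      proof
        fix x show "a' x = (a(c := t)) x"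
          using *[of x] a' t' by (cases "x \<in> insert c B") (auto simp: PiE_def extensional_def)
      qed
    qed
  qed
  then show ?thesis using fin BL sub c(1) by (auto simp: lattice_basis_def)
qed

section \<open>Agreement of circuits and ear decomposition\<close>

context regular_space
begin

text \<open>A circuit conforming to \<open>- c\<close> is supported in the support of
  \<open>c\<close>, hence is a multiple of \<open>c\<close>; unit entries and the sign leave only
  the factor -1.\<close>

lemma circuit_minus:
  assumes c: "c \<in> C"
  shows "- c \<in> C"
proof -
  obtain d where d: "d \<in> C" "conforms d (- c)"
    using circuit_conforming[of "- c"] c circuit_nonzero W_minus circuit_in by auto
  have "d $ e = 0" if "c $ e = 0" for e using d(2) that by (force simp: conforms_def)
  then obtain t where t: "d = t *\<^sub>R c" using circuit_elementary[OF c circuit_in[OF d(1)]] by blast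
  obtain e where e: "d $ e \<noteq> 0" using circuit_nonzero[OF d(1)] by (auto simp: vec_eq_iff)
  then have "0 < d $ e * (- c) $ e" using d(2) by (auto simp: conforms_def)
  then have "t = - 1" using t e
    by (cases rule: circuit_cases[OF c, of e]; cases rule: circuit_cases[OF d(1), of e]) auto
  then show ?thesis using t d(1) by simp
qed

text \<open>A common point is tight for both, which forces equality in the \<open>l1\<close>
  triangle inequality for \<open>c + d\<close>. Conversely, without cancellation the projected sign
  vector of \<open>c + d\<close> lies on both faces.\<close>

lemma circuit_faces_meet_iff:
  assumes c: "c \<in> C" and d: "d \<in> C"
  shows "circuit_face c \<inter> circuit_face d \<noteq> {} \<longleftrightarrow> (\<forall>e. 0 \<le> c $ e * d $ e)"
proof
  assume "circuit_face c \<inter> circuit_face d \<noteq> {}"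
  then obtain x where x: "x \<in> support_face c" "x \<in> support_face d" using c d by (auto simp: circuit_face_eq)
  then have "x \<bullet> (c + d) = l1 c / 2 + l1 d / 2" by (simp add: support_face_def inner_add_right)
  moreover have "x \<bullet> (c + d) \<le> l1 (c + d) / 2"
    using x W_add[OF circuit_in[OF c] circuit_in[OF d]] by (auto simp: support_face_def cell_iff_l1)
  ultimately have "l1 (c + d) = l1 c + l1 d" using l1_triangle[of c d] by linarith
  then show "\<forall>e. 0 \<le> c $ e * d $ e" by (simp add: l1_add_eq_iff)
next
  assume nn: "\<forall>e. 0 \<le> c $ e * d $ e"
  let ?x = "project (sign_vector (c + d))"
  have "0 < (c + d) $ e * c $ e" if "c $ e \<noteq> 0" for e
    using nn[rule_format, of e] that by (cases rule: circuit_cases[OF c, of e]) auto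
  then have "?x \<bullet> c = l1 c / 2" using c by (simp add: project_inner circuit_in sign_vector_inner_conform)
  moreover have "0 < (c + d) $ e * d $ e" if "d $ e \<noteq> 0" for e
    using nn[rule_format, of e] that by (cases rule: circuit_cases[OF d, of e]) auto
  then have "?x \<bullet> d = l1 d / 2" using d by (simp add: project_inner circuit_in sign_vector_inner_conform)
  moreover have "?x \<in> cell" by (intro project_cell sign_vector_bound)
  ultimately show "circuit_face c \<inter> circuit_face d \<noteq> {}"
    using c d by (auto simp: circuit_face_eq support_face_def)
qed

lemma faces_meet_pairwise_iff:
  assumes "B \<subseteq> C"
  shows "faces_meet_pairwise lattice B \<longleftrightarrow> (\<forall>c\<in>B. \<forall>d\<in>B. agree c d)"
proof -
  have "(circuit_face c \<inter> circuit_face d \<noteq> {} \<or> circuit_face c \<inter> circuit_face (- d) \<noteq> {}) \<longleftrightarrow> agree c d"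
    if "c \<in> B" "d \<in> B" for c d
    using that assms by (subst (1 2) circuit_faces_meet_iff) (auto simp: agree_def circuit_minus)
  moreover have "agree c c" for c :: "real ^ 'e" by (auto simp: agree_def)
  ultimately show ?thesis unfolding faces_meet_pairwise_def by metis
qed

lemma agree_card:
  assumes "c \<in> C" "d \<in> C" "agree c d"
  shows "real (card ({e. c $ e \<noteq> 0} \<inter> {e. d $ e \<noteq> 0})) = \<bar>c \<bullet> d\<bar>"
proof -
  have "\<bar>c $ e * d $ e\<bar> = (if e \<in> {e. c $ e \<noteq> 0} \<inter> {e. d $ e \<noteq> 0} then 1 else 0)" for e
    by (cases rule: circuit_cases[OF assms(1), of e]; cases rule: circuit_cases[OF assms(2), of e]) auto
  then show ?thesis unfolding agree_abs_inner[OF assms(3)] by (simp add: sum.If_cases Collect_conj_eq)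
qed

text \<open>
  Ear decomposition: fix a flow \<open>g\<close> vanishing nowhere and use only circuits conforming to \<open>g\<close>;
  any two of those agree. If the flows supported in \<open>H\<close> have such a basis, add a circuit \<open>c\<close> for
  which \<open>c - H\<close> is minimal: a flow supported in \<open>H \<union> c\<close> is a multiple of \<open>c\<close> up to a flow
  supported in \<open>H\<close>, for otherwise a suitable combination would contain a smaller ear.
\<close>

lemma agreeing_basis_extend:
  assumes g: "g \<in> W" "\<And>e. e \<in> ground W \<Longrightarrow> g $ e \<noteq> 0"
    and h: "h \<in> W" "conforms h g"
    and H: "H = {e. h $ e \<noteq> 0}" "H \<noteq> ground W"
    and B: "B \<subseteq> {c\<in>C. conforms c g}" "lattice_basis {v\<in>lattice. \<forall>e. v $ e \<noteq> 0 \<longrightarrow> e \<in> H} B"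
  shows "\<exists>h'\<in>W. conforms h' g \<and> H \<subset> {e. h' $ e \<noteq> 0} \<and>
     (\<exists>B'\<subseteq>{c\<in>C. conforms c g}. lattice_basis {v\<in>lattice. \<forall>e. v $ e \<noteq> 0 \<longrightarrow> h' $ e \<noteq> 0} B')"
proof -
  define ear where "ear c = {e. c $ e \<noteq> 0} - H" for c :: "real ^ 'e"
  have "H \<subseteq> ground W" using H h(1) by (auto simp: ground_def)
  then obtain e' where e': "e' \<in> ground W" "e' \<notin> H" using H(2) by blast
  then obtain c' where c': "c' \<in> C \<and> conforms c' g \<and> ear c' \<noteq> {}"
    using conforming_circuit_through[OF g(1) g(2)[OF e'(1)]] by (auto simp: ear_def)
  obtain c where c: "c \<in> C" "conforms c g" "ear c \<noteq> {}"
    and least: "\<And>d. d \<in> C \<Longrightarrow> conforms d g \<Longrightarrow> ear d \<noteq> {} \<Longrightarrow> card (ear c) \<le> card (ear d)"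
    using ex_has_least_nat[of "\<lambda>c. c \<in> C \<and> conforms c g \<and> ear c \<noteq> {}" c' "\<lambda>c. card (ear c)"] c' by blast
  define h' where "h' = h + c"
  have h'g: "0 < h' $ e * g $ e" if "h $ e \<noteq> 0 \<or> c $ e \<noteq> 0" for e
  proof (cases "h $ e \<noteq> 0 \<and> c $ e \<noteq> 0")
    case True
    then have "0 < h $ e * g $ e" "0 < c $ e * g $ e" using h(2) c(2) by (auto simp: conforms_def)
    then show ?thesis by (simp add: h'_def algebra_simps)
  next
    case False
    then show ?thesis using that h(2) c(2) by (auto simp: conforms_def h'_def)
  qed
  then have supp': "h' $ e \<noteq> 0 \<longleftrightarrow> e \<in> H \<or> c $ e \<noteq> 0" for e
    using H(1) by (cases "h $ e \<noteq> 0 \<or> c $ e \<noteq> 0") (fastforce simp: h'_def)+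
  have h'conf: "conforms h' g" using h'g supp' H(1) by (auto simp: conforms_def)
  have reduce: "\<exists>t::int. v - of_int t *\<^sub>R c \<in> {v\<in>lattice. \<forall>e. v $ e \<noteq> 0 \<longrightarrow> e \<in> H}"
    if v: "v \<in> lattice" "\<forall>e. v $ e \<noteq> 0 \<longrightarrow> h' $ e \<noteq> 0" for v
  proof -
    \<comment> \<open>Taking the minimum over the ear makes \<open>f\<close> below vanish at
      \<open>e0\<close> while it keeps the sign of \<open>c\<close>, or 0, on the rest of the
      ear.\<close>
    have "\<exists>e0\<in>ear c. \<forall>e\<in>ear c. v $ e0 * c $ e0 \<le> v $ e * c $ e"
      using c(3) ex_min_if_finite[of "(\<lambda>e. v $ e * c $ e) ` ear c"] by (fastforce simp: not_less)
    then obtain e0 where e0: "e0 \<in> ear c" "\<And>e. e \<in> ear c \<Longrightarrow> v $ e0 * c $ e0 \<le> v $ e * c $ e" by blast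
    have "v $ e0 * c $ e0 \<in> \<int>" using v(1) circuit_lattice[OF c(1)] by (auto simp: lattice_def)
    then obtain t where t: "v $ e0 * c $ e0 = of_int t" by (elim Ints_cases)
    define f where "f = v - of_int t *\<^sub>R c"
    have cc: "c $ e * c $ e = 1" if "e \<in> ear c" for e
      using that by (cases rule: circuit_cases[OF c(1), of e]) (auto simp: ear_def)
    have fc: "f $ e * c $ e = v $ e * c $ e - of_int t" if "e \<in> ear c" for e
      using cc[OF that] by (simp add: f_def left_diff_distrib mult.assoc)
    have f0: "f $ e0 = 0" using fc[OF e0(1)] t e0(1) by (auto simp: ear_def)
    have flat: "f \<in> lattice" using v(1) circuit_lattice[OF c(1)]
      by (auto simp: lattice_def f_def W_diff W_scale)
    have fsupp: "e \<in> H \<or> e \<in> ear c" if "f $ e \<noteq> 0" for e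
      using that v(2) supp'[of e] by (cases "c $ e = 0") (auto simp: f_def ear_def)
    have "f $ e1 = 0" if e1: "e1 \<in> ear c" for e1
    proof (rule ccontr)
      assume ne: "f $ e1 \<noteq> 0"
      \<comment> \<open>Large enough for \<open>M * h\<close> to outweigh \<open>f\<close> on
        \<open>H\<close>. Adding it makes the signs on \<open>H\<close> those of \<open>g\<close>
        and leaves the ear unchanged, so \<open>f'\<close> conforms to \<open>g\<close>.\<close>
      define M where "M = (\<Sum>e\<in>UNIV. \<bar>f $ e\<bar> / \<bar>h $ e\<bar>) + 1"
      have M: "\<bar>f $ e\<bar> < M * \<bar>h $ e\<bar>" if "e \<in> H" for e
      proof -
        have "\<bar>f $ e\<bar> / \<bar>h $ e\<bar> < M"
          using member_le_sum[of e UNIV "\<lambda>e. \<bar>f $ e\<bar> / \<bar>h $ e\<bar>"] by (simp add: M_def)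
        then show ?thesis using that H(1) by (simp add: pos_divide_less_eq)
      qed
      define f' where "f' = f + M *\<^sub>R h"
      have f'W: "f' \<in> W" using flat h(1) by (simp add: f'_def lattice_def W_add W_scale)
      have f'ear: "f' $ e = f $ e" if "e \<in> ear c" for e using that H(1) by (simp add: f'_def ear_def)
      have f'g: "0 < f' $ e * g $ e" if "f' $ e \<noteq> 0" for e
      proof (cases "e \<in> H")
        case True
        have "0 < h $ e * g $ e" using True h(2) H(1) by (auto simp: conforms_def)
        then show ?thesis using M[OF True] by (auto simp: f'_def zero_less_mult_iff abs_if split: if_splits)
      next
        case False
        then have "e \<in> ear c" using that H(1) fsupp by (auto simp: f'_def)
        then have "0 \<le> f $ e * c $ e" "f $ e \<noteq> 0" "0 < c $ e * g $ e"
          using fc e0(2) t that f'ear c(2) by (auto simp: ear_def conforms_def)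
        then show ?thesis using f'ear[OF \<open>e \<in> ear c\<close>]
          by (auto simp: zero_less_mult_iff zero_le_mult_iff)
      qed
      obtain d where d: "d \<in> C" "conforms d f'" "d $ e1 \<noteq> 0"
        using conforming_circuit_through[OF f'W, of e1] ne f'ear[OF e1] by auto
      have df': "f' $ e \<noteq> 0 \<and> 0 < d $ e * f' $ e" if "d $ e \<noteq> 0" for e
        using that d(2) by (force simp: conforms_def)
      have "conforms d g" unfolding conforms_def
      proof (intro allI impI)
        fix e assume "d $ e \<noteq> 0"
        then have "0 < d $ e * f' $ e" "0 < f' $ e * g $ e" using df' f'g by auto
        then show "0 < d $ e * g $ e" by (auto simp: zero_less_mult_iff)
      qed
      moreover have "e1 \<in> ear d" using d(3) e1 by (simp add: ear_def)
      ultimately have "card (ear c) \<le> card (ear d)" using d(1) by (intro least) auto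
      \<comment> \<open>Outside \<open>H\<close>, \<open>d\<close> lives where \<open>f\<close> does
        not vanish, so it misses \<open>e0\<close>: a nonempty ear smaller than the minimal
        one.\<close>
      have "ear d \<subseteq> ear c - {e0}"
      proof
        fix e assume e: "e \<in> ear d"
        then have "f' $ e \<noteq> 0" "e \<notin> H" using df' by (auto simp: ear_def)
        then have "f $ e \<noteq> 0" using H(1) by (simp add: f'_def)
        then show "e \<in> ear c - {e0}" using f0 fsupp \<open>e \<notin> H\<close> by auto
      qed
      then have "card (ear d) < card (ear c)" using e0(1) by (intro psubset_card_mono) auto
      then show False using \<open>card (ear c) \<le> card (ear d)\<close> by simp
    qed
    then have "e \<in> H" if "f $ e \<noteq> 0" for e using that fsupp by blast
    then show ?thesis using flat unfolding f_def by blast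
  qed
  obtain e where e: "e \<in> ear c" using c(3) by blast
  have "lattice_basis {v\<in>lattice. \<forall>e. v $ e \<noteq> 0 \<longrightarrow> h' $ e \<noteq> 0} (insert c B)"
  proof (rule lattice_basis_insert[OF B(2), where e = e])
    show "\<exists>t::int. v - of_int t *\<^sub>R c \<in> {v\<in>lattice. \<forall>e. v $ e \<noteq> 0 \<longrightarrow> e \<in> H}"
      if "v \<in> {v\<in>lattice. \<forall>e. v $ e \<noteq> 0 \<longrightarrow> h' $ e \<noteq> 0}" for v
      using that by (intro reduce) auto
    show "c \<in> {v\<in>lattice. \<forall>e. v $ e \<noteq> 0 \<longrightarrow> h' $ e \<noteq> 0}"
      using supp' circuit_lattice[OF c(1)] by blast
    show "{v\<in>lattice. \<forall>e. v $ e \<noteq> 0 \<longrightarrow> e \<in> H} \<subseteq> {v\<in>lattice. \<forall>e. v $ e \<noteq> 0 \<longrightarrow> h' $ e \<noteq> 0}"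
      using supp' by blast
    show "c $ e \<noteq> 0" using e by (simp add: ear_def)
    show "v $ e = 0" if "v \<in> {v\<in>lattice. \<forall>e. v $ e \<noteq> 0 \<longrightarrow> e \<in> H}" for v
      using that e unfolding ear_def by blast
  qed
  moreover have "insert c B \<subseteq> {c\<in>C. conforms c g}" using B(1) c by simp
  moreover have "H \<subset> {e. h' $ e \<noteq> 0}" using e supp' by (auto simp: ear_def)
  moreover have "h' \<in> W" using h(1) circuit_in[OF c(1)] by (simp add: h'_def W_add)
  ultimately show ?thesis using h'conf by blast
qed

lemma agreeing_basis_exists:
  "\<exists>B\<subseteq>C. lattice_basis lattice B \<and> (\<forall>c\<in>B. \<forall>d\<in>B. agree c d)"
proof -
  obtain g where g: "g \<in> W" "\<And>e. e \<in> ground W \<Longrightarrow> g $ e \<noteq> 0"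
    using ex_nowhere_zero[OF subspace_W, of "ground W"] by auto
  define good where "good h \<longleftrightarrow> h \<in> W \<and> conforms h g \<and>
     (\<exists>B\<subseteq>{c\<in>C. conforms c g}. lattice_basis {v\<in>lattice. \<forall>e. v $ e \<noteq> 0 \<longrightarrow> h $ e \<noteq> 0} B)" for h
  have zero: "{v\<in>lattice. \<forall>e. v $ e \<noteq> 0 \<longrightarrow> (0 :: real ^ 'e) $ e \<noteq> 0} = {0}"
    by (auto simp: lattice_def vec_eq_iff)
  have "good 0"
    unfolding good_def zero by (intro conjI exI[of _ "{}"]) (simp_all add: conforms_def lattice_basis_def)
  then obtain h where h: "good h" and max: "\<And>h'. good h' \<Longrightarrow> card {e. h' $ e \<noteq> 0} \<le> card {e. h $ e \<noteq> 0}"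
    using ex_has_greatest_nat[of good 0 "\<lambda>h. card {e. h $ e \<noteq> 0}" "Suc (card (UNIV :: 'e set))"]
    by (auto simp: less_Suc_eq_le card_mono)
  then obtain B where B: "B \<subseteq> {c\<in>C. conforms c g}"
    "lattice_basis {v\<in>lattice. \<forall>e. v $ e \<noteq> 0 \<longrightarrow> h $ e \<noteq> 0} B" by (auto simp: good_def)
  have "{e. h $ e \<noteq> 0} = ground W"
  proof (rule ccontr)
    assume "{e. h $ e \<noteq> 0} \<noteq> ground W"
    then obtain h' where h': "good h'" "{e. h $ e \<noteq> 0} \<subset> {e. h' $ e \<noteq> 0}"
      using agreeing_basis_extend[OF g, of h "{e. h $ e \<noteq> 0}" B] h B unfolding good_def mem_Collect_eq
      by blast
    then show False using max[OF h'(1)] psubset_card_mono[OF _ h'(2)] by simp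
  qed
  then have "{v\<in>lattice. \<forall>e. v $ e \<noteq> 0 \<longrightarrow> h $ e \<noteq> 0} = lattice"
    by (auto simp: lattice_def ground_def)
  moreover have "agree c d" if "conforms c g" "conforms d g" for c d
  proof -
    have "0 \<le> c $ e * d $ e" for e
    proof (cases "c $ e = 0 \<or> d $ e = 0")
      case False
      then have "0 < c $ e * g $ e" "0 < d $ e * g $ e" using that by (auto simp: conforms_def)
      then show ?thesis by (auto simp: zero_less_mult_iff zero_le_mult_iff)
    qed auto
    then show ?thesis by (auto simp: agree_def)
  qed
  ultimately show ?thesis using B by (intro exI[of _ B] conjI) (simp_all, blast+)
qed

section \<open>The multiplicities of the edge classes\<close>

definition fibre :: "(real ^ 'e) set set \<Rightarrow> 'e set" where
  "fibre k = {e\<in>ground W. edge_class e = k}"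

definition multiplicity :: "(real ^ 'e) set set \<Rightarrow> nat" where
  "multiplicity = (\<lambda>k\<in>edge_classes lattice. card (fibre k))"

lemma circuit_support_ground: "c \<in> C \<Longrightarrow> {e. c $ e \<noteq> 0} \<subseteq> ground W"
  using circuit_in by (auto simp: ground_def)

lemma fibre_edge_class:
  assumes "a \<in> ground W"
  shows "fibre (edge_class a) = {f. parallel_in W f a}"
proof -
  have "f \<in> ground W \<and> edge_class f = edge_class a \<longleftrightarrow> parallel_in W f a" for f
    using edge_class_eq_iff[OF _ assms, of f] parallel_in_ground[of W f a] assms by blast
  then show ?thesis by (simp add: fibre_def)
qed

lemma fibre_Union: "(\<Union>k\<in>edge_classes lattice. fibre k) = ground W"
  by (auto simp: fibre_def edge_classes_eq)

lemma fibre_avoiding: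
  assumes c: "c \<in> C"
  shows "(\<Union>k\<in>classes_avoiding lattice (circuit_face c). fibre k) = {e. c $ e \<noteq> 0}"
    and "k \<in> edge_classes lattice \<Longrightarrow> e \<in> fibre k \<Longrightarrow>
      c $ e \<noteq> 0 \<longleftrightarrow> (\<forall>\<epsilon>\<in>k. \<not> \<epsilon> \<subseteq> circuit_face c)"
proof -
  show iff: "c $ e \<noteq> 0 \<longleftrightarrow> (\<forall>\<epsilon>\<in>k. \<not> \<epsilon> \<subseteq> circuit_face c)"
    if "k \<in> edge_classes lattice" "e \<in> fibre k" for k e
    using that edge_class_avoids_iff[OF c, of e] by (auto simp: fibre_def)
  have "(\<Union>k\<in>classes_avoiding lattice (circuit_face c). fibre k)
      = {e \<in> (\<Union>k\<in>edge_classes lattice. fibre k). c $ e \<noteq> 0}"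
    using iff unfolding classes_avoiding_def by blast
  also have "\<dots> = {e. c $ e \<noteq> 0}"
    using circuit_support_ground[OF c] by (auto simp: fibre_Union)
  finally show "(\<Union>k\<in>classes_avoiding lattice (circuit_face c). fibre k) = {e. c $ e \<noteq> 0}" .
qed

lemma fibre_disjoint: "k \<noteq> l \<Longrightarrow> fibre k \<inter> fibre l = {}"
  by (auto simp: fibre_def)

lemma card_fibre_pos: "k \<in> edge_classes lattice \<Longrightarrow> 0 < card (fibre k)"
  by (subst card_gt_0_iff) (auto simp: fibre_def edge_classes_eq)

text \<open>A general summand serves two purposes: the constant 1 counts edges for the existence of
  the solution, and a signed weight gives the bilinear form for its uniqueness.\<close>

lemma sum_over_classes:
  fixes \<phi> :: "'e \<Rightarrow> 'a::comm_monoid_add"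
  assumes c: "c \<in> C" and d: "d \<in> C"
  shows "(\<Sum>k\<in>classes_avoiding lattice (circuit_face c) \<inter> classes_avoiding lattice (circuit_face d).
            \<Sum>e\<in>fibre k. \<phi> e) = (\<Sum>e\<in>{e. c $ e \<noteq> 0} \<inter> {e. d $ e \<noteq> 0}. \<phi> e)"
proof -
  let ?K = "classes_avoiding lattice (circuit_face c) \<inter> classes_avoiding lattice (circuit_face d)"
  have "(\<Union>k\<in>?K. fibre k) = {e. c $ e \<noteq> 0} \<inter> {e. d $ e \<noteq> 0}"
    unfolding fibre_avoiding(1)[OF c, symmetric] fibre_avoiding(1)[OF d, symmetric]
    by (auto simp: fibre_def)
  moreover have "finite ?K" using finite_edge_classes by (auto simp: classes_avoiding_def)
  then have "(\<Sum>k\<in>?K. \<Sum>e\<in>fibre k. \<phi> e) = sum \<phi> (\<Union>k\<in>?K. fibre k)"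
    by (intro sum.UNION_disjoint[symmetric]) (auto simp: fibre_disjoint)
  ultimately show ?thesis by simp
qed

lemma multiplicity_solution:
  assumes B: "B \<subseteq> C" and agr: "\<And>c d. c \<in> B \<Longrightarrow> d \<in> B \<Longrightarrow> agree c d"
  shows "positive_solution lattice B multiplicity"
proof -
  have *: "real (\<Sum>k\<in>classes_avoiding lattice (circuit_face c) \<inter> classes_avoiding lattice (circuit_face d).
      multiplicity k) = \<bar>c \<bullet> d\<bar>" if "c \<in> B" "d \<in> B" for c d
  proof -
    have cd: "c \<in> C" "d \<in> C" using that B by auto
    have "(\<Sum>k\<in>classes_avoiding lattice (circuit_face c) \<inter> classes_avoiding lattice (circuit_face d).
        multiplicity k) = (\<Sum>k\<in>classes_avoiding lattice (circuit_face c) \<inter>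
          classes_avoiding lattice (circuit_face d). \<Sum>e\<in>fibre k. 1)"
      by (intro sum.cong) (auto simp: multiplicity_def classes_avoiding_def)
    also have "\<dots> = card ({e. c $ e \<noteq> 0} \<inter> {e. d $ e \<noteq> 0})"
      unfolding sum_over_classes[OF cd] by simp
    finally show ?thesis using agree_card[OF cd agr[OF that]] by simp
  qed
  have "multiplicity \<in> edge_classes lattice \<rightarrow>\<^sub>E {1..}"
    using card_fibre_pos by (simp add: multiplicity_def Suc_le_eq)
  moreover have "real (\<Sum>k\<in>classes_avoiding lattice (circuit_face c). multiplicity k) = c \<bullet> c" if "c \<in> B" for c
    using *[OF that that] by simp
  ultimately show ?thesis unfolding positive_solution_def using * by blast
qed

text \<open>The difference of two solutions, turned into edge weights, is a diagonal form vanishing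
  on pairs of basis circuits, hence on \<open>W\<close>. By \<open>squares_independent\<close> its
  class sums are 0, and these are the differences.\<close>

lemma positive_solution_unique:
  assumes B: "B \<subseteq> C" "lattice_basis lattice B" and agr: "\<And>c d. c \<in> B \<Longrightarrow> d \<in> B \<Longrightarrow> agree c d"
    and n: "positive_solution lattice B n" and m: "positive_solution lattice B m"
  shows "n = m"
proof -
  define \<delta> where "\<delta> k = real (n k) - real (m k)" for k
  \<comment> \<open>Only the sum over each fibre matters; the difference is spread evenly over
    it.\<close>
  define d where "d e = (if e \<in> ground W then \<delta> (edge_class e) / real (card (fibre (edge_class e))) else 0)" for e
  have dfib: "(\<Sum>e\<in>fibre k. d e) = \<delta> k" if "k \<in> edge_classes lattice" for k
  proof -
    have "(\<Sum>e\<in>fibre k. d e) = (\<Sum>e\<in>fibre k. \<delta> k / real (card (fibre k)))"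
      by (intro sum.cong) (auto simp: d_def fibre_def)
    then show ?thesis using card_fibre_pos[OF that] by (auto simp: card_gt_0_iff)
  qed
  have sol: "real (\<Sum>k\<in>classes_avoiding lattice (circuit_face b) \<inter> classes_avoiding lattice (circuit_face b'). p k)
      = \<bar>b \<bullet> b'\<bar>" if "positive_solution lattice B p" "b \<in> B" "b' \<in> B" for p b b'
    using that by (cases "b = b'") (auto simp: positive_solution_def)
  have basis0: "(\<Sum>e\<in>UNIV. d e * x $ e * y $ e) = 0" if xy: "x \<in> B" "y \<in> B" for x y
  proof -
    have xyC: "x \<in> C" "y \<in> C" using xy B by auto
    let ?K = "classes_avoiding lattice (circuit_face x) \<inter> classes_avoiding lattice (circuit_face y)"
    let ?A = "{e. x $ e \<noteq> 0} \<inter> {e. y $ e \<noteq> 0}"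
    obtain s where s: "s \<in> {-1, 1::real}" "\<And>e. 0 \<le> s * (x $ e * y $ e)"
      using agr[OF xy] unfolding agree_def by blast
    \<comment> \<open>Agreement makes every nonzero product of entries equal to the same sign
      \<open>s\<close>, which removes the absolute value from the equation.\<close>
    have "d e * x $ e * y $ e = (if e \<in> ?A then s * d e else 0)" for e
      using s(1) s(2)[of e]
      by (cases rule: circuit_cases[OF xyC(1), of e]; cases rule: circuit_cases[OF xyC(2), of e]) auto
    then have "(\<Sum>e\<in>UNIV. d e * x $ e * y $ e) = s * (\<Sum>e\<in>?A. d e)"
      by (simp add: sum.If_cases sum_distrib_left Collect_conj_eq)
    also have "(\<Sum>e\<in>?A. d e) = (\<Sum>k\<in>?K. \<delta> k)"
      unfolding sum_over_classes[OF xyC, symmetric]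
      by (intro sum.cong) (auto simp: dfib classes_avoiding_def)
    also have "\<dots> = 0"
      using sol[OF n xy] sol[OF m xy] by (simp add: \<delta>_def sum_subtractf)
    finally show ?thesis by simp
  qed
  have WB: "W \<subseteq> span B"
  proof -
    have "v \<in> span B" if v: "v \<in> lattice" for v
    proof -
      obtain a :: "real ^ 'e \<Rightarrow> int" where "v = (\<Sum>b\<in>B. of_int (a b) *\<^sub>R b)"
        using B(2) v unfolding lattice_basis_def by blast
      then show ?thesis by (auto intro!: span_sum span_scale intro: span_base)
    qed
    then have "span lattice \<subseteq> span B" by (intro span_minimal) auto
    then show ?thesis by (simp add: span_lattice)
  qed
  have sub: "subspace {x. (\<Sum>e\<in>UNIV. d e * x $ e * y $ e) = 0}" for y :: "real ^ 'e"
  proof (rule subspaceI; clarsimp)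
    fix x z :: "real ^ 'e"
    assume "(\<Sum>e\<in>UNIV. d e * x $ e * y $ e) = 0" "(\<Sum>e\<in>UNIV. d e * z $ e * y $ e) = 0"
    then show "(\<Sum>e\<in>UNIV. d e * (x $ e + z $ e) * y $ e) = 0"
      by (simp add: algebra_simps sum.distrib)
  next
    fix r and x :: "real ^ 'e"
    assume "(\<Sum>e\<in>UNIV. d e * x $ e * y $ e) = 0"
    then have "r * (\<Sum>e\<in>UNIV. d e * x $ e * y $ e) = 0" by simp
    then show "(\<Sum>e\<in>UNIV. d e * (r * x $ e) * y $ e) = 0"
      by (simp add: sum_distrib_left mult_ac)
  qed
  have 1: "(\<Sum>e\<in>UNIV. d e * x $ e * y $ e) = 0" if "x \<in> W" "y \<in> B" for x y
    using span_minimal[OF _ sub, of B y] basis0 that WB by blast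
  have 2: "(\<Sum>e\<in>UNIV. d e * x $ e * y $ e) = 0" if "x \<in> W" "y \<in> W" for x y
  proof -
    have sw: "(\<Sum>e\<in>UNIV. d e * x $ e * z $ e) = (\<Sum>e\<in>UNIV. d e * z $ e * x $ e)" for z :: "real ^ 'e"
      by (simp add: mult_ac)
    have "B \<subseteq> {z. (\<Sum>e\<in>UNIV. d e * z $ e * x $ e) = 0}" using 1[OF that(1)] sw by auto
    then have "span B \<subseteq> {z. (\<Sum>e\<in>UNIV. d e * z $ e * x $ e) = 0}" by (intro span_minimal sub)
    then show ?thesis using that(2) WB sw by auto
  qed
  have "\<delta> k = 0" if k: "k \<in> edge_classes lattice" for k
  proof -
    obtain a where a: "a \<in> ground W" "k = edge_class a" using k by (auto simp: edge_classes_eq)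
    have "(\<Sum>f | parallel_in W f a. d f) = 0"
      using regular_space_axioms 2 a(1) by (rule squares_independent)
    then show ?thesis using dfib[OF k] fibre_edge_class[OF a(1)] a(2) by simp
  qed
  then show "n = m" using n m
    by (intro PiE_ext[of n "edge_classes lattice" "\<lambda>_. {1..}"]) (auto simp: positive_solution_def \<delta>_def)
qed

section \<open>The reconstructed matroid\<close>

lemma circuit_support_inject:
  assumes c: "c \<in> C" and d: "d \<in> C" and sub: "{e. c $ e \<noteq> 0} \<subseteq> {e. d $ e \<noteq> 0}"
  shows "c = d \<or> c = - d"
proof -
  obtain t where t: "c = t *\<^sub>R d" using circuit_elementary[OF d circuit_in[OF c]] sub by blast
  obtain e where "c $ e \<noteq> 0" using circuit_nonzero[OF c] by (auto simp: vec_eq_iff)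
  then have "t = 1 \<or> t = -1" using t
    by (cases rule: circuit_cases[OF c, of e]; cases rule: circuit_cases[OF d, of e]) auto
  then show ?thesis using t by auto
qed

lemma matroid_circuits: "matroid (ground W, (\<lambda>c. {e. c $ e \<noteq> 0}) ` C)"
proof -
  have nonempty: "{e. c $ e \<noteq> 0} \<noteq> {}" if "c \<in> C" for c
    using circuit_nonzero[OF that] by (auto simp: vec_eq_iff)
  have minimal: "{e. c $ e \<noteq> 0} = {e. d $ e \<noteq> 0}"
    if "c \<in> C" "d \<in> C" "{e. c $ e \<noteq> 0} \<subseteq> {e. d $ e \<noteq> 0}" for c d
    using circuit_support_inject[OF that] by auto
  have elim: "\<exists>k\<in>C. {e. k $ e \<noteq> 0} \<subseteq> {e. c $ e \<noteq> 0} \<union> {e. d $ e \<noteq> 0} - {e}"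
    if c: "c \<in> C" and d: "d \<in> C" and e: "c $ e \<noteq> 0" "d $ e \<noteq> 0"
      and ne: "{e. c $ e \<noteq> 0} \<noteq> {e. d $ e \<noteq> 0}" for c d e
  proof -
    \<comment> \<open>For unit entries the product equals the quotient of \<open>c $ e\<close> by
      \<open>d $ e\<close>, so \<open>c - r *\<^sub>R d\<close> cancels at \<open>e\<close>.\<close>
    define r where "r = c $ e * d $ e"
    have "r \<noteq> 0" using e by (simp add: r_def)
    define x where "x = c - r *\<^sub>R d"
    have xW: "x \<in> W" using c d by (simp add: x_def W_diff W_scale circuit_in)
    have xe: "x $ e = 0" using e
      by (cases rule: circuit_cases[OF c, of e]; cases rule: circuit_cases[OF d, of e]) (auto simp: x_def r_def)
    have "x \<noteq> 0"
    proof
      assume "x = 0"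
      then have "c = r *\<^sub>R d" by (simp add: x_def)
      then have "c $ f \<noteq> 0 \<longleftrightarrow> d $ f \<noteq> 0" for f using \<open>r \<noteq> 0\<close> by simp
      then show False using ne by blast
    qed
    then obtain k where k: "k \<in> C" "conforms k x" using circuit_conforming xW by blast
    then have kx: "x $ f \<noteq> 0" if "k $ f \<noteq> 0" for f using that by (force simp: conforms_def)
    have "c $ f \<noteq> 0 \<or> d $ f \<noteq> 0" if "k $ f \<noteq> 0" for f using kx[OF that] by (auto simp: x_def)
    then show ?thesis using k(1) kx xe by (intro bexI[of _ k]) blast+
  qed
  show ?thesis
    unfolding matroid_def prod.case
  proof (intro conjI ballI impI)
    show "{} \<notin> (\<lambda>c. {e. c $ e \<noteq> 0}) ` C" using nonempty by blast
    show "D \<subseteq> ground W" if "D \<in> (\<lambda>c. {e. c $ e \<noteq> 0}) ` C" for D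
      using that circuit_support_ground by blast
    show "D = D'" if "D \<in> (\<lambda>c. {e. c $ e \<noteq> 0}) ` C" "D' \<in> (\<lambda>c. {e. c $ e \<noteq> 0}) ` C" "D \<subseteq> D'" for D D'
    proof -
      obtain c d where "c \<in> C" "D = {e. c $ e \<noteq> 0}" "d \<in> C" "D' = {e. d $ e \<noteq> 0}" using \<open>D \<in> _\<close> \<open>D' \<in> _\<close> by blast
      then show ?thesis using minimal \<open>D \<subseteq> D'\<close> by simp
    qed
    show "\<exists>K\<in>(\<lambda>c. {e. c $ e \<noteq> 0}) ` C. K \<subseteq> D \<union> D' - {e}"
      if "D \<in> (\<lambda>c. {e. c $ e \<noteq> 0}) ` C" "D' \<in> (\<lambda>c. {e. c $ e \<noteq> 0}) ` C" "e \<in> D \<inter> D'" "D \<noteq> D'" for D D' e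
    proof -
      obtain c d where cd: "c \<in> C" "D = {e. c $ e \<noteq> 0}" "d \<in> C" "D' = {e. d $ e \<noteq> 0}"
        using \<open>D \<in> _\<close> \<open>D' \<in> _\<close> by blast
      then show ?thesis unfolding bex_simps
        using elim[OF cd(1,3), of e] \<open>e \<in> D \<inter> D'\<close> \<open>D \<noteq> D'\<close> by simp
    qed
  qed simp
qed

end

text \<open>Pulls the circuit axioms back along \<open>f\<close>. Injectivity is known on
  \<open>E\<close> only, hence the assumption that circuits lie in \<open>E\<close>.\<close>

lemma matroid_isomorphic_imp_matroid:
  assumes f: "bij_betw f E E'" and img: "(\<lambda>D. f ` D) ` \<C> = \<D>"
    and ground: "\<And>D. D \<in> \<C> \<Longrightarrow> D \<subseteq> E" and M: "matroid (E', \<D>)"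
  shows "matroid (E, \<C>)"
proof -
  have inj: "inj_on f E" using f by (auto simp: bij_betw_def)
  have fin: "finite E'" and ne: "{} \<notin> \<D>"
    and min: "\<And>D D'. D \<in> \<D> \<Longrightarrow> D' \<in> \<D> \<Longrightarrow> D \<subseteq> D' \<Longrightarrow> D = D'"
    and elim: "\<And>D D' e. D \<in> \<D> \<Longrightarrow> D' \<in> \<D> \<Longrightarrow> e \<in> D \<inter> D' \<Longrightarrow> D \<noteq> D' \<Longrightarrow> \<exists>K\<in>\<D>. K \<subseteq> D \<union> D' - {e}"
    using M unfolding matroid_def by simp_all
  have finE: "finite E" using fin f bij_betw_finite by blast
  have mem: "f ` D \<in> \<D>" if "D \<in> \<C>" for D using that img by blast
  have sub: "D \<subseteq> D'" if "D \<subseteq> E" "D' \<subseteq> E" "f ` D \<subseteq> f ` D'" for D D'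
    using that inj by (meson inj_on_image_subset_iff)
  have "D = D'" if "D \<in> \<C>" "D' \<in> \<C>" "D \<subseteq> D'" for D D'
    using min[OF mem mem, OF that(1,2)] that ground inj_on_image_eq_iff[OF inj] by (meson image_mono)
  moreover have "\<exists>K\<in>\<C>. K \<subseteq> D \<union> D' - {e}"
    if D: "D \<in> \<C>" "D' \<in> \<C>" "e \<in> D \<inter> D'" "D \<noteq> D'" for D D' e
  proof -
    have "f ` D \<noteq> f ` D'" using inj_on_image_eq_iff[OF inj ground[OF D(1)] ground[OF D(2)]] D(4) by simp
    then obtain K' where K': "K' \<in> \<D>" "K' \<subseteq> f ` D \<union> f ` D' - {f e}"
      using elim[OF mem mem, OF D(1,2), of "f e"] D(3) by blast
    then obtain K where K: "K \<in> \<C>" "K' = f ` K" using img by blast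
    have "f ` K \<subseteq> f ` (D \<union> D')" using K' K(2) by blast
    then have "K \<subseteq> D \<union> D'" using sub ground D K(1) by (meson Un_least)
    moreover have "e \<notin> K" using K' K(2) by blast
    ultimately show ?thesis using K(1) by blast
  qed
  moreover have "{} \<notin> \<C>" using ne mem by force
  ultimately show ?thesis using finE ground unfolding matroid_def by simp
qed

context regular_space
begin

lemma reconstructed_matroid_isomorphic:
  fixes S :: "(real ^ 'e) set set \<Rightarrow> 'x set"
  assumes S: "\<And>k. k \<in> edge_classes lattice \<Longrightarrow> card (S k) = card (fibre k)"
  shows "matroid_isomorphic (reconstructed_matroid lattice S) (ground W, (\<lambda>c. {e. c $ e \<noteq> 0}) ` C)"
    and "matroid (reconstructed_matroid lattice S)"
proof -
  let ?E = "Sigma (edge_classes lattice) S"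
  have "\<exists>h. bij_betw h (S k) (fibre k)" if "k \<in> edge_classes lattice" for k
    \<comment> \<open>A positive \<open>card\<close> excludes infinite \<open>S k\<close>, for which
      \<open>card\<close> would be 0.\<close>
    using S[OF that] card_fibre_pos[OF that] by (intro finite_same_card_bij) (auto simp: card_gt_0_iff)
  then obtain h where h: "\<And>k. k \<in> edge_classes lattice \<Longrightarrow> bij_betw (h k) (S k) (fibre k)" by metis
  define f where "f = (\<lambda>(k, x). h k x)"
  have img: "f ` Sigma K S = (\<Union>k\<in>K. fibre k)" if "K \<subseteq> edge_classes lattice" for K
  proof -
    have "f ` Sigma K S = (\<Union>k\<in>K. h k ` S k)" by (force simp: f_def)
    also have "\<dots> = (\<Union>k\<in>K. fibre k)" using h that by (intro SUP_cong) (auto simp: bij_betw_def)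
    finally show ?thesis .
  qed
  have "inj_on f ?E"
  proof (rule inj_onI, clarsimp)
    fix k x l y
    assume kl: "k \<in> edge_classes lattice" "x \<in> S k" "l \<in> edge_classes lattice" "y \<in> S l" "f (k, x) = f (l, y)"
    have "f (k, x) \<in> fibre k" using bij_betw_apply[OF h[OF kl(1)] kl(2)] by (simp add: f_def)
    moreover have "f (l, y) \<in> fibre l" using bij_betw_apply[OF h[OF kl(3)] kl(4)] by (simp add: f_def)
    ultimately have "k = l" unfolding kl(5) by (simp add: fibre_def)
    then show "k = l \<and> x = y" using kl h[OF kl(1)] by (auto simp: f_def bij_betw_def inj_on_def)
  qed
  then have bij: "bij_betw f ?E (ground W)"
    using img[of "edge_classes lattice"] fibre_Union by (simp add: bij_betw_def)
  have facets: "{F. F facet_of cell} = circuit_face ` C"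
    using facet_imp_circuit_face circuit_face_facet by blast
  have circ: "{Sigma (classes_avoiding lattice F) S | F. F facet_of cell}
      = (\<lambda>c. Sigma (classes_avoiding lattice (circuit_face c)) S) ` C"
    unfolding image_image[of "\<lambda>F. Sigma (classes_avoiding lattice F) S" circuit_face, symmetric] facets[symmetric]
    by blast
  have avoid: "classes_avoiding lattice F \<subseteq> edge_classes lattice" for F by (auto simp: classes_avoiding_def)
  have sys: "(\<lambda>D. f ` D) ` {Sigma (classes_avoiding lattice F) S | F. F facet_of cell}
      = (\<lambda>c. {e. c $ e \<noteq> 0}) ` C"
    unfolding circ image_image using avoid by (intro image_cong) (simp_all add: img fibre_avoiding)
  show "matroid_isomorphic (reconstructed_matroid lattice S) (ground W, (\<lambda>c. {e. c $ e \<noteq> 0}) ` C)"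
    unfolding matroid_isomorphic_def reconstructed_matroid_def using bij sys by auto
  show "matroid (reconstructed_matroid lattice S)"
    unfolding reconstructed_matroid_def
    by (rule matroid_isomorphic_imp_matroid[OF bij sys _ matroid_circuits]) (use avoid in blast)
qed

end

section \<open>Flows on a graph\<close>

definition flow_space :: "('v, 'e::finite) pre_digraph \<Rightarrow> (real ^ 'e) set" where
  "flow_space G =
     {f. (\<forall>e. e \<notin> arcs G \<longrightarrow> f $ e = 0) \<and>
         (\<forall>v\<in>verts G. (\<Sum>e\<in>in_arcs G v. f $ e) = (\<Sum>e\<in>out_arcs G v. f $ e))}"

definition excess :: "('v, 'e::finite) pre_digraph \<Rightarrow> real ^ 'e \<Rightarrow> 'v \<Rightarrow> real" where
  "excess G x v = (\<Sum>e\<in>in_arcs G v. x $ e) - (\<Sum>e\<in>out_arcs G v. x $ e)"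

definition dart_value :: "real ^ 'e \<Rightarrow> 'e \<times> bool \<Rightarrow> real" where
  "dart_value x d = (if snd d then x $ fst d else - x $ fst d)"

lemma flow_space_iff:
  "x \<in> flow_space G \<longleftrightarrow> (\<forall>e. e \<notin> arcs G \<longrightarrow> x $ e = 0) \<and> (\<forall>v\<in>verts G. excess G x v = 0)"
  by (simp add: flow_space_def excess_def)

lemma excess_add: "excess G (x + y) v = excess G x v + excess G y v"
  by (simp add: excess_def sum.distrib)

lemma excess_scaleR: "excess G (t *\<^sub>R x) v = t * excess G x v"
  by (simp add: excess_def sum_distrib_left right_diff_distrib)

lemma excess_axis:
  fixes G :: "('v, 'e::finite) pre_digraph"
  assumes "f \<in> arcs G"
  shows "excess G (axis f t) v = (if head G f = v then t else 0) - (if tail G f = v then t else 0)"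
proof -
  have "(\<Sum>e\<in>A. axis f t $ e) = (if f \<in> A then t else 0)" for A :: "'e set"
    by (simp add: axis_def sum.delta)
  then show ?thesis using assms by (simp add: excess_def)
qed

lemma subspace_flow_space: "subspace (flow_space G)"
  unfolding subspace_def
proof (intro conjI ballI allI)
  show "0 \<in> flow_space G" by (simp add: flow_space_def)
qed (simp_all add: flow_space_iff excess_add excess_scaleR)

lemma dart_digraph_simps [simp]:
  "verts (dart_digraph G) = verts G"
  "arcs (dart_digraph G) = arcs G \<times> UNIV"
  "tail (dart_digraph G) (e, True) = tail G e"
  "tail (dart_digraph G) (e, False) = head G e"
  "head (dart_digraph G) (e, True) = head G e"
  "head (dart_digraph G) (e, False) = tail G e"
  by (simp_all add: dart_digraph_def)

text \<open>Reversing an edge swaps its ends and negates its value, which preserves inflow minus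
  outflow. With one dart per edge of the support, an integer or real flow can be followed along
  darts as in a directed graph.\<close>

lemma excess_darts:
  fixes G :: "('v, 'e::finite) pre_digraph"
  assumes c: "c \<subseteq> arcs (dart_digraph G)" "inj_on fst c" and x: "\<And>e. e \<notin> fst ` c \<Longrightarrow> x $ e = 0"
  shows "excess G x v = (\<Sum>d | d \<in> c \<and> head (dart_digraph G) d = v. dart_value x d)
     - (\<Sum>d | d \<in> c \<and> tail (dart_digraph G) d = v. dart_value x d)"
proof -
  have fin: "finite c" using finite_imageD[OF _ c(2)] by simp
  have sub: "fst ` c \<subseteq> arcs G" using c(1) by auto
  have red: "(\<Sum>e\<in>A. x $ e) = (\<Sum>d\<in>c. if fst d \<in> A then x $ fst d else 0)" for A
  proof -
    have "(\<Sum>e\<in>A. x $ e) = (\<Sum>e\<in>A \<inter> fst ` c. x $ e)" using x by (intro sum.mono_neutral_right) auto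
    also have "\<dots> = (\<Sum>e\<in>fst ` c. if e \<in> A then x $ e else 0)"
      by (subst sum.inter_restrict[symmetric]) (auto simp: Int_commute)
    also have "\<dots> = (\<Sum>d\<in>c. if fst d \<in> A then x $ fst d else 0)"
      by (simp add: sum.reindex[OF c(2)])
    finally show ?thesis .
  qed
  have "excess G x v = (\<Sum>d\<in>c. (if head G (fst d) = v then x $ fst d else 0)
      - (if tail G (fst d) = v then x $ fst d else 0))"
    unfolding excess_def red sum_subtractf[symmetric] using sub by (intro sum.cong) auto
  also have "\<dots> = (\<Sum>d\<in>c. (if head (dart_digraph G) d = v then dart_value x d else 0)
      - (if tail (dart_digraph G) d = v then dart_value x d else 0))"
  proof (rule sum.cong)
    fix d assume "d \<in> c"
    show "(if head G (fst d) = v then x $ fst d else 0) - (if tail G (fst d) = v then x $ fst d else 0)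
      = (if head (dart_digraph G) d = v then dart_value x d else 0)
      - (if tail (dart_digraph G) d = v then dart_value x d else 0)"
      by (cases d; cases "snd d") (auto simp: dart_value_def)
  qed simp
  also have "\<dots> = (\<Sum>d | d \<in> c \<and> head (dart_digraph G) d = v. dart_value x d)
     - (\<Sum>d | d \<in> c \<and> tail (dart_digraph G) d = v. dart_value x d)"
    using fin by (simp add: sum_subtractf sum.inter_filter)
  finally show ?thesis .
qed

lemma card_inj_fibre: "inj_on h c \<Longrightarrow> card {d\<in>c. h d = v} = (if v \<in> h ` c then 1 else 0)"
proof -
  assume inj: "inj_on h c"
  show ?thesis
  proof (cases "v \<in> h ` c")
    case True
    then obtain d where "d \<in> c" "h d = v" by blast
    then have "{d\<in>c. h d = v} = {d}" using inj by (auto simp: inj_on_def)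
    then show ?thesis using True by simp
  next
    case False
    then show ?thesis by (auto simp: card_eq_0_iff)
  qed
qed

section \<open>Closed walks in a digraph\<close>

context pre_digraph
begin

lemma cas_nth: "cas u p v \<Longrightarrow> Suc i < length p \<Longrightarrow> tail G (p ! Suc i) = head G (p ! i)"
proof (induct p arbitrary: u i)
  case (Cons a p)
  then show ?case by (cases p; cases i) auto
qed simp

lemma cas_last: "cas u p v \<Longrightarrow> p \<noteq> [] \<Longrightarrow> head G (last p) = v"
  by (induct p arbitrary: u) auto

lemma cas_map_upt:
  assumes "\<And>k. head G (s k) = tail G (s (Suc k))" "i \<le> j"
  shows "cas (tail G (s i)) (map s [i..<j]) (tail G (s j))"
  using assms(2)
proof (induct "j - i" arbitrary: i)
  case (Suc m)
  then have "i < j" "m = j - Suc i" "Suc i \<le> j" by simp_all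
  then show ?case using Suc(1)[of "Suc i"] by (simp add: upt_conv_Cons assms(1))
qed simp

text \<open>The vertex list of the walk is both the tails followed by the last head and the first
  tail followed by the heads. These two end vertices coincide, so tails and heads form the same
  multiset.\<close>

lemma cycle_tails:
  assumes "cycle p"
  shows "distinct (map (head G) p)" "distinct (map (tail G) p)" "head G ` set p = tail G ` set p"
proof -
  obtain u where u: "cas u p u" "distinct (tl (awalk_verts u p))" "p \<noteq> []" "set p \<subseteq> arcs G"
    using assms by (auto simp: cycle_def awalk_def)
  have 1: "awalk_verts u p = map (tail G) p @ [head G (last p)]" using u(3) by (simp add: awalk_verts_conv)
  have 2: "awalk_verts u p = tail G (hd p) # map (head G) p" using u(1,3) by (simp add: awalk_verts_conv')
  show d: "distinct (map (head G) p)" using u(2) 2 by simp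
  have "tail G (hd p) = u" using u(1,3) by (simp add: cas_simp)
  moreover have "head G (last p) = u"
    using u(1,3) by (rule cas_last)
  ultimately have "mset (map (tail G) p) = mset (map (head G) p)"
    using arg_cong[OF trans[OF 1[symmetric] 2], of mset] by simp
  then show "distinct (map (tail G) p)" "head G ` set p = tail G ` set p"
    using d by (metis mset_eq_imp_distinct_iff, metis mset_eq_setD set_map)
qed

text \<open>Follow the arcs until a vertex repeats.\<close>

lemma cycle_in_closed_set:
  assumes P: "P \<subseteq> arcs G" "finite P" "P \<noteq> {}" and verts: "tail G ` P \<subseteq> verts G"
    and succ: "\<And>d. d \<in> P \<Longrightarrow> \<exists>d'\<in>P. tail G d' = head G d"
  shows "\<exists>p. cycle p \<and> set p \<subseteq> P \<and> distinct p"
proof -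
  obtain nx where nx: "\<And>d. d \<in> P \<Longrightarrow> nx d \<in> P \<and> tail G (nx d) = head G d" using succ by metis
  obtain d0 where "d0 \<in> P" using P(3) by blast
  define s where "s i = (nx ^^ i) d0" for i
  have sP: "s i \<in> P" for i by (induct i) (use \<open>d0 \<in> P\<close> nx in \<open>auto simp: s_def\<close>)
  have step: "head G (s k) = tail G (s (Suc k))" for k using nx[OF sP[of k]] by (simp add: s_def)
  have "\<not> inj (\<lambda>i. tail G (s i))"
  proof
    assume "inj (\<lambda>i. tail G (s i))"
    moreover have "range (\<lambda>i. tail G (s i)) \<subseteq> tail G ` P" using sP by blast
    ultimately show False using P(2) by (meson finite_imageI finite_imageD finite_subset infinite_UNIV_nat)
  qed
  then obtain a b where "tail G (s a) = tail G (s b)" "a \<noteq> b" by (auto simp: inj_on_def)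
  then have "\<exists>j i. i < j \<and> tail G (s i) = tail G (s j)" by (metis nat_neq_iff)
  \<comment> \<open>At the first repetition all earlier tails are distinct, so the arcs between the
    two visits form a cycle.\<close>
  then obtain j where j: "\<exists>i<j. tail G (s i) = tail G (s j)"
    and min: "\<And>l. l < j \<Longrightarrow> \<not> (\<exists>i<l. tail G (s i) = tail G (s l))"
    unfolding exists_least_iff[of "\<lambda>j. \<exists>i<j. tail G (s i) = tail G (s j)"] by blast
  then obtain i where i: "i < j" "tail G (s i) = tail G (s j)" by blast
  have neq: "tail G (s k) \<noteq> tail G (s l)" if "k < l" "l < j" for k l using min[OF that(2)] that(1) by blast
  define p where "p = map s [i..<j]"
  have inj: "inj_on (\<lambda>k. tail G (s k)) {i..<j}" using neq by (intro linorder_inj_onI') auto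
  have inj': "inj_on (\<lambda>k. tail G (s (Suc k))) {i..<j}"
  proof (rule linorder_inj_onI')
    fix k l assume kl: "k \<in> {i..<j}" "l \<in> {i..<j}" "k < l"
    show "tail G (s (Suc k)) \<noteq> tail G (s (Suc l))"
    \<comment> \<open>The last arc ends at the tail of \<open>s j\<close>, which is the starting
      vertex, the tail of \<open>s i\<close>.\<close>
    proof (cases "Suc l = j")
      case True
      then show ?thesis using neq[of i "Suc k"] kl i(2) by auto
    next
      case False
      then show ?thesis using neq[of "Suc k" "Suc l"] kl by auto
    qed
  qed
  have cas: "cas (tail G (s i)) p (tail G (s i))"
    using cas_map_upt[of s i j] step i by (simp add: p_def)
  have "p \<noteq> []" using i(1) by (simp add: p_def)
  moreover have "set p \<subseteq> P" using sP by (auto simp: p_def)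
  moreover have "distinct p"
    unfolding p_def distinct_map using inj by (auto simp: inj_on_def)
  moreover have "distinct (map (head G) p)"
    using inj' by (simp add: p_def distinct_map comp_def step)
  moreover have "tail G (s i) \<in> verts G" using verts sP by blast
  ultimately have "cycle p"
    using cas P(1) by (auto simp: cycle_def awalk_def awalk_verts_conv' intro!: exI[of _ "tail G (s i)"])
  then show ?thesis using \<open>set p \<subseteq> P\<close> \<open>distinct p\<close> by blast
qed

end

section \<open>Circuit elements as elementary vectors of the flow space\<close>

lemma oriented_circuit_props:
  assumes "c \<in> oriented_circuits G"
  shows "c \<noteq> {}" "c \<subseteq> arcs (dart_digraph G)" "inj_on fst c"
    "inj_on (head (dart_digraph G)) c" "inj_on (tail (dart_digraph G)) c"
    "head (dart_digraph G) ` c = tail (dart_digraph G) ` c"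
proof -
  obtain p where p: "c = set p" "pre_digraph.cycle (dart_digraph G) p" "distinct (map fst p)"
    using assms by (auto simp: oriented_circuits_def)
  note ct = pre_digraph.cycle_tails[OF p(2)]
  show "c \<noteq> {}" "c \<subseteq> arcs (dart_digraph G)"
    using p(1,2) by (auto simp: pre_digraph.cycle_def pre_digraph.awalk_def)
  show "inj_on fst c" "inj_on (head (dart_digraph G)) c" "inj_on (tail (dart_digraph G)) c"
    "head (dart_digraph G) ` c = tail (dart_digraph G) ` c"
    using p ct by (simp_all add: distinct_map)
qed

lemma circuit_element_entry:
  assumes "inj_on fst c"
  shows "(e, True) \<in> c \<longleftrightarrow> circuit_element c $ e = 1" "(e, False) \<in> c \<longleftrightarrow> circuit_element c $ e = - 1"
    "e \<in> circuit_edges c \<longleftrightarrow> circuit_element c $ e \<noteq> 0"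
proof -
  have "\<not> ((e, True) \<in> c \<and> (e, False) \<in> c)" using inj_onD[OF assms, of "(e, True)" "(e, False)"] by auto
  then show "(e, True) \<in> c \<longleftrightarrow> circuit_element c $ e = 1" "(e, False) \<in> c \<longleftrightarrow> circuit_element c $ e = - 1"
    by (auto simp: circuit_element_def)
  have "e \<in> fst ` c \<longleftrightarrow> (e, True) \<in> c \<or> (e, False) \<in> c"
    by (auto simp: image_iff Bex_def ex_bool_eq)
  then show "e \<in> circuit_edges c \<longleftrightarrow> circuit_element c $ e \<noteq> 0"
    by (auto simp: circuit_edges_def circuit_element_def)
qed

lemma circuit_element_inject:
  assumes "c \<in> oriented_circuits G" "d \<in> oriented_circuits G" "circuit_element c = circuit_element d"
  shows "c = d"
proof -
  have "(e, b) \<in> c \<longleftrightarrow> (e, b) \<in> d" for e b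
    using circuit_element_entry[OF oriented_circuit_props(3)[OF assms(1)], of e]
      circuit_element_entry[OF oriented_circuit_props(3)[OF assms(2)], of e] assms(3) by (cases b) auto
  then show ?thesis by auto
qed

lemma circuit_edges_eq: "c \<in> oriented_circuits G \<Longrightarrow> circuit_edges c = {e. circuit_element c $ e \<noteq> 0}"
  using circuit_element_entry(3)[OF oriented_circuit_props(3)] by auto

lemma dart_value_circuit_element: "inj_on fst c \<Longrightarrow> d \<in> c \<Longrightarrow> dart_value (circuit_element c) d = 1"
  using circuit_element_entry(1,2)[of c "fst d"] by (cases d; cases "snd d") (auto simp: dart_value_def)

lemma circuit_element_flow:
  assumes c: "c \<in> oriented_circuits G"
  shows "circuit_element c \<in> flow_space G"
proof -
  note p = oriented_circuit_props[OF c]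
  have z: "circuit_element c $ e = 0" if "e \<notin> fst ` c" for e
    using that circuit_element_entry(3)[OF p(3), of e] by (simp add: circuit_edges_def)
  have "excess G (circuit_element c) v = 0" for v
  proof -
    have "excess G (circuit_element c) v = real (card {d\<in>c. head (dart_digraph G) d = v})
        - real (card {d\<in>c. tail (dart_digraph G) d = v})"
      by (subst excess_darts[OF p(2,3) z]) (simp_all add: dart_value_circuit_element[OF p(3)])
    then show ?thesis by (simp add: card_inj_fibre p(4,5,6))
  qed
  moreover have "fst ` c \<subseteq> arcs G" using p(2) by auto
  ultimately show ?thesis using z unfolding flow_space_iff by blast
qed

text \<open>Every vertex of the circuit has exactly one dart entering and one leaving it, so
  conservation makes the dart values constant along the walk.\<close>

lemma flow_on_circuit:
  assumes "fin_digraph G" and c: "c \<in> oriented_circuits G" and x: "x \<in> flow_space G"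
    and supp: "\<And>e. circuit_element c $ e = 0 \<Longrightarrow> x $ e = 0"
  shows "\<exists>t. x = t *\<^sub>R circuit_element c"
proof -
  interpret fin_digraph G by fact
  let ?D = "dart_digraph G"
  obtain p where p: "c = set p" "pre_digraph.cycle ?D p" using c by (auto simp: oriented_circuits_def)
  then obtain u where u: "pre_digraph.cas ?D u p u" "p \<noteq> []"
    by (auto simp: pre_digraph.cycle_def pre_digraph.awalk_def)
  note q = oriented_circuit_props[OF c]
  have z: "x $ e = 0" if "e \<notin> fst ` c" for e
    using that circuit_element_entry(3)[OF q(3), of e] supp by (simp add: circuit_edges_def)
  have "dart_value x (p ! Suc i) = dart_value x (p ! i)" if i: "Suc i < length p" for i
  proof -
    have mem: "p ! i \<in> c" "p ! Suc i \<in> c" using i p(1) by auto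
    let ?v = "head ?D (p ! i)"
    have tail: "tail ?D (p ! Suc i) = ?v" using pre_digraph.cas_nth[OF u(1) i] .
    have "fst (p ! i) \<in> arcs G" using mem q(2) by auto
    then have "?v \<in> verts G" by (cases "p ! i"; cases "snd (p ! i)") auto
    then have "0 = excess G x ?v" using x by (simp add: flow_space_iff)
    also have "\<dots> = (\<Sum>d | d \<in> c \<and> head ?D d = ?v. dart_value x d)
        - (\<Sum>d | d \<in> c \<and> tail ?D d = ?v. dart_value x d)"
      by (rule excess_darts[OF q(2,3) z])
    also have "{d. d \<in> c \<and> head ?D d = ?v} = {p ! i}" using inj_onD[OF q(4)] mem by blast
    also have "{d. d \<in> c \<and> tail ?D d = ?v} = {p ! Suc i}"
    proof -
      have "d = p ! Suc i" if "d \<in> c" "tail ?D d = ?v" for d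
        using inj_onD[OF q(5) _ that(1) mem(2)] that(2) tail by simp
      then show ?thesis using mem(2) tail by blast
    qed
    finally show ?thesis by simp
  qed
  then have const: "dart_value x (p ! i) = dart_value x (p ! 0)" if "i < length p" for i
    using that by (induct i) auto
  have "x $ e = dart_value x (p ! 0) * circuit_element c $ e" for e
  proof (cases "e \<in> fst ` c")
    case True
    then obtain b where b: "(e, b) \<in> c" by force
    then have "dart_value x (e, b) = dart_value x (p ! 0)" using const p(1) by (metis in_set_conv_nth)
    then show ?thesis using b circuit_element_entry(1,2)[OF q(3), of e]
      by (cases b) (auto simp: dart_value_def)
  next
    case False
    then show ?thesis using z circuit_element_entry(3)[OF q(3), of e] by (simp add: circuit_edges_def)
  qed
  then show ?thesis by (intro exI[of _ "dart_value x (p ! 0)"]) (simp add: vec_eq_iff)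
qed

text \<open>On the darts along which \<open>x\<close> is positive, conservation provides a
  successor: what enters a vertex must leave it. Any cycle among these darts conforms to
  \<open>x\<close>.\<close>

lemma flow_conforming_circuit:
  assumes "fin_digraph G" and x: "x \<in> flow_space G" "x \<noteq> 0"
  shows "\<exists>c\<in>oriented_circuits G. conforms (circuit_element c) x"
proof -
  interpret fin_digraph G by fact
  let ?D = "dart_digraph G"
  define P where "P = {d\<in>arcs ?D. 0 < dart_value x d}"
  have inj: "inj_on fst P"
    by (rule inj_onI) (auto simp: P_def dart_value_def split: if_splits)
  have z: "x $ e = 0" if "e \<notin> fst ` P" for e
  proof (rule ccontr)
    assume ne: "x $ e \<noteq> 0"
    then have "e \<in> arcs G" using x(1) by (auto simp: flow_space_iff)
    then have "(e, 0 < x $ e) \<in> P" using ne by (auto simp: P_def dart_value_def)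
    then show False using that by force
  qed
  have PD: "P \<subseteq> arcs ?D" by (auto simp: P_def)
  have fin: "finite P" using finite_imageD[OF _ inj] by simp
  obtain e where "x $ e \<noteq> 0" using x(2) by (auto simp: vec_eq_iff)
  then have "P \<noteq> {}" using z[of e] by auto
  moreover have dv: "tail ?D d \<in> verts ?D \<and> head ?D d \<in> verts ?D" if "d \<in> P" for d
    using that by (cases d; cases "snd d") (auto simp: P_def)
  moreover have "\<exists>d'\<in>P. tail ?D d' = head ?D d" if d: "d \<in> P" for d
  proof (rule ccontr)
    assume no: "\<not> (\<exists>d'\<in>P. tail ?D d' = head ?D d)"
    then have "(\<Sum>d' | d' \<in> P \<and> tail ?D d' = head ?D d. dart_value x d') = 0" by (intro sum.neutral) blast
    then have "excess G x (head ?D d) = (\<Sum>d' | d' \<in> P \<and> head ?D d' = head ?D d. dart_value x d')"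
      using excess_darts[OF PD inj z, of "head ?D d"] by linarith
    moreover have "excess G x (head ?D d) = 0" using x(1) dv[OF d] by (auto simp: flow_space_iff)
    moreover have "0 < (\<Sum>d' | d' \<in> P \<and> head ?D d' = head ?D d. dart_value x d')"
      using fin d by (intro sum_pos) (auto simp: P_def)
    ultimately show False by simp
  qed
  ultimately obtain p where p: "pre_digraph.cycle ?D p" "set p \<subseteq> P" "distinct p"
    using pre_digraph.cycle_in_closed_set[OF PD fin] by blast
  have "distinct (map fst p)" using p(2,3) inj by (auto simp: distinct_map intro: inj_on_subset)
  then have c: "set p \<in> oriented_circuits G" using p(1) by (auto simp: oriented_circuits_def)
  have "0 < circuit_element (set p) $ e * x $ e" if "circuit_element (set p) $ e \<noteq> 0" for e
    using that p(2) unfolding circuit_element_def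
    by (auto simp: P_def dart_value_def split: if_splits)
  then show ?thesis using c by (auto simp: conforms_def)
qed

lemma regular_space_flows:
  assumes "fin_digraph G"
  shows "regular_space (flow_space G) (circuit_element ` oriented_circuits G)"
proof
  show "subspace (flow_space G)" by (rule subspace_flow_space)
next
  fix c assume "c \<in> circuit_element ` oriented_circuits G"
  then obtain d where d: "d \<in> oriented_circuits G" "c = circuit_element d" by blast
  then show "c \<in> flow_space G" by (simp add: circuit_element_flow)
  obtain e where "e \<in> circuit_edges d" using oriented_circuit_props(1)[OF d(1)] by (auto simp: circuit_edges_def)
  then show "c \<noteq> 0" using circuit_edges_eq[OF d(1)] d(2) by auto
  show "c $ e \<in> {-1, 0, 1}" for e unfolding d(2) circuit_element_def by auto
  show "\<exists>t. x = t *\<^sub>R c" if "x \<in> flow_space G" "\<And>e. c $ e = 0 \<Longrightarrow> x $ e = 0" for x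
    using flow_on_circuit[OF assms d(1)] that d(2) by blast
next
  fix x assume "x \<in> flow_space G" "x \<noteq> 0"
  then show "\<exists>c\<in>circuit_element ` oriented_circuits G. conforms c x"
    using flow_conforming_circuit[OF assms] by blast
qed

text \<open>Some walk from the head to the tail of \<open>e\<close> avoids \<open>e\<close>. A unit
  sent along it has excess only at the two ends, and one unit on \<open>e\<close> cancels
  both.\<close>

lemma flow_through_arc:
  assumes "fin_digraph G" and two: "two_edge_connected G" and e: "e \<in> arcs G"
  shows "\<exists>x\<in>flow_space G. x $ e \<noteq> 0"
proof -
  interpret fin_digraph G by fact
  let ?H = "mk_symmetric (del_arc e)"
  have "head G e \<rightarrow>\<^sup>*\<^bsub>?H\<^esub> tail G e"
    using two e by (auto simp: two_edge_connected_def connected_def strongly_connected_def)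
  then have "(head G e, tail G e) \<in> (arcs_ends ?H)\<^sup>*" by (rule reachable_rtranclI)
  then have "\<exists>y :: real ^ 'b. (\<forall>f. f \<notin> arcs G - {e} \<longrightarrow> y $ f = 0) \<and>
    (\<forall>z. excess G y z = (if z = tail G e then 1 else 0) - (if z = head G e then 1 else 0))"
  proof (induct rule: rtrancl_induct)
    case base
    show ?case by (rule exI[of _ 0]) (simp add: excess_def)
  next
    case (step v w)
    then obtain y :: "real ^ 'b" where y: "\<forall>f. f \<notin> arcs G - {e} \<longrightarrow> y $ f = 0"
      "\<forall>z. excess G y z = (if z = v then 1 else 0) - (if z = head G e then 1 else 0)" by blast
    have "(v, w) \<in> parcs ?H" using step(2) by simp
    then obtain f where f: "f \<in> arcs G - {e}" "v = tail G f \<and> w = head G f \<or> v = head G f \<and> w = tail G f"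
      by (auto simp: parcs_mk_symmetric)
    \<comment> \<open>The sign depends on the direction in which the step traverses
      \<open>f\<close>; either way one unit moves from \<open>v\<close> to \<open>w\<close>.\<close>
    obtain t :: real where t: "\<forall>z. excess G (axis f t) z = (if z = w then 1 else 0) - (if z = v then 1 else 0)"
    proof (cases "v = tail G f \<and> w = head G f")
      case True
      then show thesis using f(1) that[of 1] by (auto simp: excess_axis)
    next
      case False
      then show thesis using f that[of "- 1"] by (auto simp: excess_axis)
    qed
    show ?case
      by (rule exI[of _ "y + axis f t"]) (use y t f(1) in \<open>auto simp: excess_add axis_def\<close>)
  qed
  then obtain y :: "real ^ 'b" where y: "\<forall>f. f \<notin> arcs G - {e} \<longrightarrow> y $ f = 0"
    "\<forall>z. excess G y z = (if z = tail G e then 1 else 0) - (if z = head G e then 1 else 0)" by blast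
  have "excess G (y + axis e 1) z = 0" for z using y(2) e by (simp add: excess_add excess_axis)
  moreover have "(y + axis e 1) $ f = 0" if "f \<notin> arcs G" for f using y(1) e that by (auto simp: axis_def)
  ultimately have "y + axis e 1 \<in> flow_space G" by (simp add: flow_space_iff)
  moreover have "(y + axis e 1) $ e = 1" using y(1) by (simp add: axis_def)
  ultimately show ?thesis by (intro bexI[of _ "y + axis e 1"]) auto
qed

theorem theorem3p13:
  fixes G :: "('v, 'e::finite) pre_digraph"
    and L :: "(real ^ 'e) set"
  assumes "fin_digraph G"
    and "Digraph_Component.connected G"
    and "two_edge_connected G"
    and L_def: "L = flow_lattice G"
  shows
    \<comment> \<open>the codimension one faces and the edges can be listed; the codimension one faces are the
        \<open>F\<^sub>C\<close>, and \<open>C\<close> can be read off from the lattice\<close>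
    "finite {F. F facet_of voronoi_cell L} \<and> finite (cell_edges L) \<and>
     (\<forall>F. F facet_of voronoi_cell L \<longrightarrow>
        (\<exists>!c. c \<in> oriented_circuits G \<and> F = voronoi_face L (circuit_element c))) \<and>
     (\<forall>v\<in>L. voronoi_face L v facet_of voronoi_cell L \<longleftrightarrow>
        v \<in> circuit_element ` oriented_circuits G) \<and>
     (\<exists>B. circuit_basis G B \<and> faces_meet_pairwise L B) \<and>
     (\<forall>B. circuit_basis G B \<and> faces_meet_pairwise L B \<longrightarrow>
        cancellation_free G B \<and>
        (\<exists>!n. positive_solution L B n) \<and>
        (\<forall>n. positive_solution L B n \<longrightarrow>
           (\<exists>S :: (real ^ 'e) set set \<Rightarrow> 'e set.
              disjoint_family_on S (edge_classes L) \<and>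
              (\<Union>k\<in>edge_classes L. S k) = arcs G \<and>
              (\<forall>k\<in>edge_classes L. card (S k) = n k) \<and>
              (\<forall>k\<in>edge_classes L. \<forall>e\<in>S k. \<forall>c\<in>oriented_circuits G.
                 e \<in> circuit_edges c \<longleftrightarrow>
                 (\<forall>\<epsilon>\<in>k. \<not> \<epsilon> \<subseteq> voronoi_face L (circuit_element c)))) \<and>
           (\<forall>S :: (real ^ 'e) set set \<Rightarrow> 'x set.
              (\<forall>k\<in>edge_classes L. card (S k) = n k) \<longrightarrow>
              matroid (reconstructed_matroid L S) \<and>
              matroid_isomorphic (reconstructed_matroid L S) (graphic_matroid G))))"
proof -
  let ?C = "circuit_element ` oriented_circuits G"
  interpret regular_space "flow_space G" ?C using assms(1) by (rule regular_space_flows)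
  have L: "lattice = L"
    unfolding lattice_def unfolding L_def flow_lattice_def flow_space_def by auto
  \<comment> \<open>No arc is a bridge, so the classes, which only see \<open>ground\<close>,
    account for the whole ground set of the matroid.\<close>
  have ground: "ground (flow_space G) = arcs G"
    using flow_through_arc[OF assms(1,3)] by (auto simp: ground_def flow_space_def)
  have graphic: "graphic_matroid G = (ground (flow_space G), (\<lambda>c. {e. c $ e \<noteq> 0}) ` ?C)"
    by (simp add: graphic_matroid_def ground image_image circuit_edges_eq cong: image_cong)
  have facets: "\<exists>!c. c \<in> oriented_circuits G \<and> F = voronoi_face L (circuit_element c)"
    if F: "F facet_of voronoi_cell L" for F
  proof -
    obtain c where c: "c \<in> oriented_circuits G" "F = voronoi_face L (circuit_element c)"
      using facet_imp_circuit_face[of F] F unfolding L by blast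
    have "d = c" if "d \<in> oriented_circuits G" "F = voronoi_face L (circuit_element d)" for d
      using circuit_face_inject[of "circuit_element d" "circuit_element c"] circuit_element_inject that c L by auto
    then show ?thesis using c by blast
  qed
  have basis: "\<exists>B. circuit_basis G B \<and> faces_meet_pairwise L B"
  proof -
    obtain B where B: "B \<subseteq> ?C" "lattice_basis lattice B" "\<forall>c\<in>B. \<forall>d\<in>B. agree c d"
      using agreeing_basis_exists by blast
    then have "faces_meet_pairwise L B" using faces_meet_pairwise_iff[OF B(1)] L by simp
    moreover have "circuit_basis G B" using B(1,2) L L_def by (simp add: circuit_basis_def)
    ultimately show ?thesis by blast
  qed
  have main: "cancellation_free G B \<and> positive_solution L B multiplicity \<and>
      (\<forall>n. positive_solution L B n \<longrightarrow> n = multiplicity)"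
    if B: "circuit_basis G B" "faces_meet_pairwise L B" for B
  proof -
    have BC: "B \<subseteq> ?C" and bas: "lattice_basis lattice B"
      using B(1) by (auto simp: circuit_basis_def L L_def)
    have agr: "agree c d" if "c \<in> B" "d \<in> B" for c d
      using that B(2) faces_meet_pairwise_iff[OF BC] L by auto
    have "cancellation_free G B"
      unfolding cancellation_free_def
    proof (intro ballI impI)
      fix c d
      assume "c \<in> oriented_circuits G" "d \<in> oriented_circuits G" "circuit_element c \<in> B" "circuit_element d \<in> B"
      then show "real (card (circuit_edges c \<inter> circuit_edges d)) = \<bar>circuit_element c \<bullet> circuit_element d\<bar>"
        using agree_card[of "circuit_element c" "circuit_element d"] agr by (simp add: circuit_edges_eq)
    qed
    moreover have sol: "positive_solution lattice B multiplicity" using BC agr by (rule multiplicity_solution)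
    moreover have "n = multiplicity" if "positive_solution lattice B n" for n
      using BC bas agr that sol by (rule positive_solution_unique)
    ultimately show ?thesis unfolding L by blast
  qed
  have ground_set: "disjoint_family_on fibre (edge_classes L) \<and> (\<Union>k\<in>edge_classes L. fibre k) = arcs G \<and>
      (\<forall>k\<in>edge_classes L. card (fibre k) = multiplicity k) \<and>
      (\<forall>k\<in>edge_classes L. \<forall>e\<in>fibre k. \<forall>c\<in>oriented_circuits G. e \<in> circuit_edges c \<longleftrightarrow>
         (\<forall>\<epsilon>\<in>k. \<not> \<epsilon> \<subseteq> voronoi_face L (circuit_element c)))"
    unfolding L[symmetric]
  proof (intro conjI ballI)
    show "disjoint_family_on fibre (edge_classes lattice)" by (simp add: disjoint_family_on_def fibre_disjoint)
    show "(\<Union>k\<in>edge_classes lattice. fibre k) = arcs G" using fibre_Union ground by simp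
    show "card (fibre k) = multiplicity k" if "k \<in> edge_classes lattice" for k
      using that by (simp add: multiplicity_def)
    fix k e c
    assume "k \<in> edge_classes lattice" "e \<in> fibre k" "c \<in> oriented_circuits G"
    then show "e \<in> circuit_edges c \<longleftrightarrow> (\<forall>\<epsilon>\<in>k. \<not> \<epsilon> \<subseteq> voronoi_face lattice (circuit_element c))"
      using fibre_avoiding(2)[of "circuit_element c" k e] by (simp add: circuit_edges_eq)
  qed
  have reconstruct: "matroid (reconstructed_matroid L S) \<and>
      matroid_isomorphic (reconstructed_matroid L S) (graphic_matroid G)"
    if "\<forall>k\<in>edge_classes L. card (S k) = multiplicity k" for S :: "(real ^ 'e) set set \<Rightarrow> 'x set"
    using reconstructed_matroid_isomorphic[of S] that by (simp add: L graphic multiplicity_def)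
  have last: "\<forall>B. circuit_basis G B \<and> faces_meet_pairwise L B \<longrightarrow>
        cancellation_free G B \<and>
        (\<exists>!n. positive_solution L B n) \<and>
        (\<forall>n. positive_solution L B n \<longrightarrow>
           (\<exists>S :: (real ^ 'e) set set \<Rightarrow> 'e set.
              disjoint_family_on S (edge_classes L) \<and>
              (\<Union>k\<in>edge_classes L. S k) = arcs G \<and>
              (\<forall>k\<in>edge_classes L. card (S k) = n k) \<and>
              (\<forall>k\<in>edge_classes L. \<forall>e\<in>S k. \<forall>c\<in>oriented_circuits G.
                 e \<in> circuit_edges c \<longleftrightarrow>
                 (\<forall>\<epsilon>\<in>k. \<not> \<epsilon> \<subseteq> voronoi_face L (circuit_element c)))) \<and>
           (\<forall>S :: (real ^ 'e) set set \<Rightarrow> 'x set.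
              (\<forall>k\<in>edge_classes L. card (S k) = n k) \<longrightarrow>
              matroid (reconstructed_matroid L S) \<and>
              matroid_isomorphic (reconstructed_matroid L S) (graphic_matroid G)))"
  proof (intro allI impI, elim conjE, intro conjI allI impI)
    fix B assume B: "circuit_basis G B" "faces_meet_pairwise L B"
    note m = main[OF B]
    show "cancellation_free G B" using m by blast
    show "\<exists>!n. positive_solution L B n" using m by blast
    fix n assume "positive_solution L B n"
    then have n: "n = multiplicity" using m by blast
    show "\<exists>S :: (real ^ 'e) set set \<Rightarrow> 'e set.
              disjoint_family_on S (edge_classes L) \<and>
              (\<Union>k\<in>edge_classes L. S k) = arcs G \<and>
              (\<forall>k\<in>edge_classes L. card (S k) = n k) \<and>
              (\<forall>k\<in>edge_classes L. \<forall>e\<in>S k. \<forall>c\<in>oriented_circuits G.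
                 e \<in> circuit_edges c \<longleftrightarrow>
                 (\<forall>\<epsilon>\<in>k. \<not> \<epsilon> \<subseteq> voronoi_face L (circuit_element c)))"
      unfolding n using ground_set by (rule exI[of _ fibre])
    fix S :: "(real ^ 'e) set set \<Rightarrow> 'x set"
    assume "\<forall>k\<in>edge_classes L. card (S k) = n k"
    then show "matroid (reconstructed_matroid L S)"
      and "matroid_isomorphic (reconstructed_matroid L S) (graphic_matroid G)"
      using reconstruct[of S] unfolding n by blast+
  qed
  show ?thesis
    using finite_facets finite_cell_edges voronoi_face_facet_iff facets basis last unfolding L by blast
qed

end
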